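(* Let $t>0$ and suppose $f\in H(\tanh 2t)$. Then there is a constant $C>0$ (depending on $f$ and $t$) such that for all integers $n\ge 1$, $$\left|\langle f,\varphi_n\rangle+\frac{n(n+2)}{\sqrt{\prod_{j=1}^{4}(n+j)}}\,e^{4t}\,\langle f,\varphi_{n+4}\rangle\right|\le C\,n^{-3/4}e^{-nt}.$$
   Context: The Fourier transform of $f\in L^1(\mathbb{R})$ is $\widehat f(\xi)=\frac{1}{\sqrt{2\pi}}\int_{\mathbb{R}} f(x)e^{-i\xi x}\,dx$. For $0<a<1$ let $g_a(x)=e^{-ax^2/2}$ and define the Hardy class $$H(a)=\{f\in L^1(\mathbb{R}) : f(x)=O(g_a(x)) \text{ and } \widehat f(\xi)=O(g_a(\xi))\},$$ where the $O$-bounds are uniform over all $x\in\mathbb{R}$ (resp. $\xi\in\mathbb{R}$). $\varphi_n$ denotes the $n$-th normalized Hermite function, $\varphi_n(x)=(2^n n!\sqrt{\pi})^{-1/2}H_n(x)e^{-x^2/2}$ with $H_n$ the (physicists') Hermite polynomial, so that $\{\varphi_n\}_{n\ge 0}$ is an orthonormal basis of $L^2(\mathbb{R})$; $\langle f,g\rangle=\int_{\mathbb{R}} f\overline{g}$. *)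

theory Defs
  imports "HOL-Analysis.Analysis"
begin

fun hermite_poly :: "nat \<Rightarrow> real \<Rightarrow> real" where
  "hermite_poly 0 x = 1"
| "hermite_poly (Suc 0) x = 2 * x"
| "hermite_poly (Suc (Suc n)) x = 2 * x * hermite_poly (Suc n) x - 2 * real (Suc n) * hermite_poly n x"

definition hermite_fun :: "nat \<Rightarrow> real \<Rightarrow> real" where
  "hermite_fun n x = hermite_poly n x * exp (- (x\<^sup>2) / 2) / sqrt (2 ^ n * fact n * sqrt pi)"

definition fourier :: "(real \<Rightarrow> complex) \<Rightarrow> real \<Rightarrow> complex" where
  "fourier f \<xi> = complex_of_real (1 / sqrt (2 * pi)) *
      (LINT x|lborel. f x * exp (- \<i> * complex_of_real (\<xi> * x)))"

definition gauss :: "real \<Rightarrow> real \<Rightarrow> real" where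
  "gauss a x = exp (- a * x\<^sup>2 / 2)"

definition hardy_class :: "real \<Rightarrow> (real \<Rightarrow> complex) set" where
  "hardy_class a = {f. integrable lborel f \<and>
      (\<exists>C. \<forall>x. norm (f x) \<le> C * gauss a x) \<and>
      (\<exists>C. \<forall>\<xi>. norm (fourier f \<xi>) \<le> C * gauss a \<xi>)}"

definition hermite_coeff :: "(real \<Rightarrow> complex) \<Rightarrow> nat \<Rightarrow> complex" where
  "hermite_coeff f n = (LINT x|lborel. f x * cnj (complex_of_real (hermite_fun n x)))"

end

theory Submission
  imports Defs "HOL-Complex_Analysis.Complex_Analysis" "HOL-Probability.Probability"
begin

text \<open>
  Up to a constant, the Hermite coefficients of \<open>f\<close>, divided by \<open>\<surd>(n!)\<close>, are the Taylor
  coefficients of its Bargmann transform \<open>F\<close>, and the combination to be bounded becomes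
  \<open>b\<^sub>n + n (n + 2) e\<^sup>4\<^sup>t b\<^sub>n\<^sub>+\<^sub>4\<close>. The decay of \<open>f\<close> and of its Fourier transform gives two
  Gaussian bounds for \<open>F\<close>, one good near the real and one near the imaginary axis. On the sector
  between the directions where the first or second bound touches \<open>exp (e\<^sup>-\<^sup>2\<^sup>t \<bar>Im z\<^sup>2\<bar> / 2)\<close>,
  the Phragmen-Lindelof principle improves them to this common tangent. Hence on the circle of radius
  \<open>r = \<surd>n e\<^sup>t\<close> the function \<open>F\<close> has size at most \<open>e\<^sup>n\<^sup>/\<^sup>2\<close> and is concentrated within
  angle \<open>n\<^sup>-\<^sup>1\<^sup>/\<^sup>2\<close> of the four diagonals. In Cauchy's formula the combination contributes the factor
  \<open>1 + (1 + 2/n) e\<^sup>-\<^sup>4\<^sup>i\<^sup>\<theta>\<close>, which nearly vanishes on the diagonals and gains another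
  \<open>n\<^sup>-\<^sup>1\<^sup>/\<^sup>2\<close>; Stirling's bound for \<open>n!\<close> finishes the proof.
\<close>

section \<open>A Phragmen-Lindelof principle\<close>

text \<open>The critical growth rate for a strip of half-width \<alpha> is
  \<open>pi / (2 * \<alpha>)\<close>. Below that rate a regularizing factor makes the function small
  on a far right edge, so the maximum principle on a rectangle applies; the factor is then removed
  in the limit.\<close>

lemma phragmen_lindelof_half_strip:
  fixes H :: "complex \<Rightarrow> complex"
  assumes hol: "H holomorphic_on UNIV"
    and "0 < C" and sig: "0 < \<sigma>" "\<sigma> * \<alpha> < pi / 2"
    and left: "\<And>z. Re z = 0 \<Longrightarrow> \<bar>Im z\<bar> \<le> \<alpha> \<Longrightarrow> norm (H z) \<le> C"
    and sides: "\<And>z. 0 \<le> Re z \<Longrightarrow> \<bar>Im z\<bar> = \<alpha> \<Longrightarrow> norm (H z) \<le> C"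
    and growth: "\<And>z. 0 \<le> Re z \<Longrightarrow> \<bar>Im z\<bar> \<le> \<alpha> \<Longrightarrow> norm (H z) \<le> A * exp (M * exp (\<sigma> * Re z))"
    and w: "0 \<le> Re w" "\<bar>Im w\<bar> \<le> \<alpha>"
  shows "norm (H w) \<le> C"
proof -
  have \<alpha>: "\<alpha> \<ge> 0" using w by linarith
  \<comment> \<open>A rate strictly above \<sigma> that still satisfies
    \<open>\<rho> * \<alpha> < pi / 2\<close>. The denominator contains \<open>\<alpha> + 1\<close>
    so that the degenerate strip \<open>\<alpha> = 0\<close> is covered.\<close>
  define \<rho> where "\<rho> = \<sigma> + (pi / 2 - \<sigma> * \<alpha>) / (2 * (\<alpha> + 1))"
  have \<rho>\<sigma>: "\<rho> > \<sigma>" using sig \<alpha> by (simp add: \<rho>_def)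
  have "(pi / 2 - \<sigma> * \<alpha>) / (2 * (\<alpha> + 1)) * \<alpha> \<le> (pi / 2 - \<sigma> * \<alpha>) / 2"
    using sig \<alpha> by (simp add: divide_simps)
  also have "\<dots> < pi / 2 - \<sigma> * \<alpha>" proof -
    have "d / 2 < d" if "d > 0" for d :: real using that by simp
    then show ?thesis using sig(2) by (metis diff_gt_0_iff_gt)
  qed
  finally have \<rho>\<alpha>: "\<rho> * \<alpha> < pi / 2" by (simp add: \<rho>_def algebra_simps)
  have \<rho>0: "\<rho> > 0" using \<rho>\<sigma> sig by linarith
  define \<delta> where "\<delta> = cos (\<rho> * \<alpha>)"
  have \<delta>: "\<delta> > 0" unfolding \<delta>_def using \<rho>\<alpha> \<rho>0 \<alpha>
    by (intro cos_gt_zero_pi) (auto intro: less_le_trans[of _ 0])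
  \<comment> \<open>Since \<open>\<sigma> < \<rho>\<close>, the factor \<open>exp (- \<epsilon> exp (\<rho> z))\<close> beats the growth; since \<open>\<rho> \<alpha> < \<pi> / 2\<close>,
    it is at most 1 in modulus on the strip.\<close>
  define E where "E = (\<lambda>\<epsilon> z. H z * exp (- complex_of_real \<epsilon> * exp (complex_of_real \<rho> * z)))"
  have decay: "norm (exp (- complex_of_real \<epsilon> * exp (complex_of_real \<rho> * z)))
      \<le> exp (- \<epsilon> * \<delta> * exp (\<rho> * Re z))" if "\<epsilon> > 0" "\<bar>Im z\<bar> \<le> \<alpha>" for \<epsilon> z
  proof -
    have "\<rho> * \<bar>Im z\<bar> \<le> \<rho> * \<alpha>" using that \<rho>0 by simp
    moreover have \<rho>\<alpha>': "\<rho> * \<alpha> \<le> pi" using \<rho>\<alpha> pi_gt_zero by linarith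
    ultimately have "cos (\<rho> * \<alpha>) \<le> cos (\<rho> * \<bar>Im z\<bar>)"
      using \<rho>0 \<rho>\<alpha>' by (intro cos_monotone_0_pi_le) simp_all
    also have "\<dots> = cos (\<rho> * Im z)" by (simp add: abs_if)
    finally have "\<delta> \<le> cos (\<rho> * Im z)" by (simp add: \<delta>_def)
    then have "\<epsilon> * (exp (\<rho> * Re z) * \<delta>) \<le> \<epsilon> * (exp (\<rho> * Re z) * cos (\<rho> * Im z))"
      using that by (intro mult_left_mono) auto
    then show ?thesis by (simp add: Re_exp mult_ac)
  qed
  have bound_eps: "norm (E \<epsilon> w) \<le> C" if \<epsilon>: "\<epsilon> > 0" for \<epsilon>
  proof -
    have "((\<lambda>x. A * exp (M * exp (\<sigma> * x)) * exp (- \<epsilon> * \<delta> * exp (\<rho> * x))) \<longlongrightarrow> 0) at_top"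
    proof -
      have "((\<lambda>x. M * exp (\<sigma> * x) - \<epsilon> * \<delta> * exp (\<rho> * x)) = (\<lambda>x. - (exp (\<sigma> * x) * (\<epsilon> * \<delta> * exp ((\<rho> - \<sigma>) * x) - M))))"
        by (auto simp: algebra_simps simp flip: exp_add)
      moreover have "filterlim (\<lambda>x. exp (\<sigma> * x) * (\<epsilon> * \<delta> * exp ((\<rho> - \<sigma>) * x) - M)) at_top at_top"
      proof (rule filterlim_at_top_mult_at_top)
        show "filterlim (\<lambda>x. exp (\<sigma> * x)) at_top at_top"
          using sig by (intro filterlim_compose[OF exp_at_top] filterlim_tendsto_pos_mult_at_top[OF tendsto_const]) (auto simp: filterlim_ident)
        have "filterlim (\<lambda>x. exp ((\<rho> - \<sigma>) * x)) at_top at_top"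
          using \<rho>\<sigma> by (intro filterlim_compose[OF exp_at_top] filterlim_tendsto_pos_mult_at_top[OF tendsto_const]) (auto simp: filterlim_ident)
        then have "filterlim (\<lambda>x. \<epsilon> * \<delta> * exp ((\<rho> - \<sigma>) * x)) at_top at_top"
          using \<epsilon> \<delta> by (intro filterlim_tendsto_pos_mult_at_top[OF tendsto_const]) auto
        then show "filterlim (\<lambda>x. \<epsilon> * \<delta> * exp ((\<rho> - \<sigma>) * x) - M) at_top at_top"
          using filterlim_tendsto_add_at_top[OF tendsto_const[of "- M"]] by simp
      qed
      ultimately have "filterlim (\<lambda>x. M * exp (\<sigma> * x) - \<epsilon> * \<delta> * exp (\<rho> * x)) at_bot at_top"
        by (simp add: filterlim_uminus_at_bot)
      then have "((\<lambda>x. exp (M * exp (\<sigma> * x) - \<epsilon> * \<delta> * exp (\<rho> * x))) \<longlongrightarrow> 0) at_top"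
        by (rule filterlim_compose[OF exp_at_bot])
      then have "((\<lambda>x. A * exp (M * exp (\<sigma> * x) - \<epsilon> * \<delta> * exp (\<rho> * x))) \<longlongrightarrow> 0) at_top"
        by (rule tendsto_mult_right_zero)
      then show ?thesis by (simp add: exp_diff exp_minus field_simps)
    qed
      \<comment> \<open>The right edge of the rectangle is placed beyond \<open>w\<close>, far
        enough out that the damped growth bound is already below \<open>C\<close>.\<close>
      have "eventually (\<lambda>x. A * exp (M * exp (\<sigma> * x)) * exp (- \<epsilon> * \<delta> * exp (\<rho> * x)) < C \<and> x > Re w) at_top"
        by (intro eventually_conj order_tendstoD(2)[OF \<open>(_ \<longlongrightarrow> 0) at_top\<close> \<open>C > 0\<close>] eventually_gt_at_top)
      then obtain R where R: "A * exp (M * exp (\<sigma> * R)) * exp (- \<epsilon> * \<delta> * exp (\<rho> * R)) < C" "R > Re w"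
        using eventually_happens'[OF trivial_limit_at_top_linorder] by blast
      define S where "S = cbox (Complex 0 (-\<alpha>)) (Complex R \<alpha>)"
      show ?thesis
      proof (rule maximum_modulus_frontier[of "E \<epsilon>" S])
        show "E \<epsilon> holomorphic_on interior S" unfolding E_def
          by (intro holomorphic_intros holomorphic_on_subset[OF hol]) auto
        show "continuous_on (closure S) (E \<epsilon>)" unfolding E_def
          by (intro continuous_intros continuous_on_subset[OF holomorphic_on_imp_continuous_on[OF hol]]) auto
        show "bounded S" by (simp add: S_def)
        show "w \<in> S" using w R by (auto simp: S_def in_cbox_complex_iff)
        fix z assume "z \<in> frontier S"
        then have z: "0 \<le> Re z" "Re z \<le> R" "\<bar>Im z\<bar> \<le> \<alpha>" "Re z = 0 \<or> Re z = R \<or> \<bar>Im z\<bar> = \<alpha>"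
          by (auto simp: S_def frontier_cbox in_cbox_complex_iff in_box_complex_iff)
        note d = decay[OF \<epsilon> z(3)]
        have d1: "exp (- \<epsilon> * \<delta> * exp (\<rho> * Re z)) \<le> 1" using \<epsilon> \<delta> by simp
        have triv: "norm (E \<epsilon> z) \<le> C" if "norm (H z) \<le> C"
          unfolding E_def norm_mult using mult_mono[OF that order_trans[OF d d1]] \<open>0 < C\<close> by simp
        show "norm (E \<epsilon> z) \<le> C"
        proof (cases "Re z = R")
          case True
          have "norm (E \<epsilon> z) \<le> A * exp (M * exp (\<sigma> * Re z)) * exp (- \<epsilon> * \<delta> * exp (\<rho> * Re z))"
            unfolding E_def norm_mult
            using growth[OF z(1,3)] by (intro mult_mono d) (auto intro: order_trans[OF norm_ge_zero])
          then show ?thesis using R True by simp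
        next
          case False
          then show ?thesis using z left sides triv by blast
        qed
      qed
  qed
  \<comment> \<open>The bound at \<open>w\<close> is uniform in \<epsilon>, so it survives the limit
    in which the damping factor tends to 1.\<close>
  have "((\<lambda>\<epsilon>. norm (E \<epsilon> w)) \<longlongrightarrow> norm (E 0 w)) (at_right 0)"
    unfolding E_def by (intro tendsto_intros)
  moreover have "eventually (\<lambda>\<epsilon>. norm (E \<epsilon> w) \<le> C) (at_right 0)"
    using bound_eps by (auto simp: eventually_at_filter)
  ultimately have "norm (E 0 w) \<le> C"
    by (intro tendsto_upperbound) auto
  then show ?thesis by (simp add: E_def)
qed

section \<open>Growth in sectors around the diagonals\<close>

lemma half_le_sin:
  fixes y :: real
  assumes "0 \<le> y" "y \<le> pi / 3"
  shows "y / 2 \<le> sin y"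
proof -
  have "sin 0 - 0 / 2 \<le> sin y - y / 2"
  proof (rule DERIV_nonneg_imp_nondecreasing[OF assms(1)])
    fix x assume x: "0 \<le> x" "x \<le> y"
    have "cos (pi / 3) \<le> cos x"
      using x assms by (intro cos_monotone_0_pi_le) auto
    then show "\<exists>d. ((\<lambda>y. sin y - y / 2) has_real_derivative d) (at x) \<and> 0 \<le> d"
      by (intro exI[of _ "cos x - 1 / 2"]) (auto simp: cos_60 intro!: derivative_eq_intros)
  qed
  then show ?thesis by simp
qed

text \<open>The angle \<open>2 * \<alpha>\<close> is the Gudermannian of \<open>s\<close>. It is
  where \<open>cosh s - sinh s * sin \<theta>\<close> touches \<open>cos \<theta>\<close> from
  above: both values are \<open>1 / cosh s\<close> and both slopes are
  \<open>- tanh s\<close>.\<close>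

lemma
  fixes s :: real
  assumes "s > 0"
  defines "\<alpha> \<equiv> arcsin (tanh s) / 2"
  shows gudermann_pos: "0 < \<alpha>" and gudermann_less: "\<alpha> < pi / 4"
    and sin_gudermann: "sin (2 * \<alpha>) = tanh s" and cos_gudermann: "cos (2 * \<alpha>) = 1 / cosh s"
proof -
  have t: "0 < tanh s" "tanh s < 1" using assms tanh_real_lt_1 by auto
  have t': "- 1 \<le> tanh s" using t by linarith
  show "0 < \<alpha>" using t arcsin_less_arcsin[of 0 "tanh s"] by (simp add: \<alpha>_def)
  show "\<alpha> < pi / 4" using t t' arcsin_less_arcsin[of "tanh s" 1] by (simp add: \<alpha>_def)
  show "sin (2 * \<alpha>) = tanh s" using t t' by (simp add: \<alpha>_def)
  have c: "cosh s > 0" by simp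
  have "(cosh s)\<^sup>2 > 0" using c by simp
  then have sq: "1 - (tanh s)\<^sup>2 = (1 / cosh s)\<^sup>2"
    unfolding tanh_def power_divide by (simp add: divide_simps cosh_square_eq)
  have "cos (2 * \<alpha>) = sqrt (1 - (tanh s)\<^sup>2)" using t t' by (simp add: \<alpha>_def cos_arcsin)
  also have "1 - (tanh s)\<^sup>2 = (1 / cosh s)\<^sup>2"
    by (rule sq)
  finally show "cos (2 * \<alpha>) = 1 / cosh s" by simp
qed

text \<open>
  At \<open>\<bar>Im \<zeta>\<bar> = arcsin (tanh s) / 2\<close> the hypothesis, written in terms of \<open>z\<^sup>2 = \<i> exp (2 \<zeta>)\<close>,
  reads \<open>\<bar>F z\<bar> \<le> C exp (b Im z\<^sup>2)\<close>, because \<open>cosh s - sinh s tanh s = 1 / cosh s\<close>.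
\<close>
lemma sector_bound:
  fixes F :: "complex \<Rightarrow> complex"
  assumes hol: "F holomorphic_on UNIV" and pos: "C > 0" "b > 0" "s > 0"
    and bnd: "\<And>z. norm (F z) \<le> C * exp (b * (cosh s * (norm z)\<^sup>2 - sinh s * \<bar>Re (z\<^sup>2)\<bar>))"
    and \<zeta>: "0 \<le> Re \<zeta>" "\<bar>Im \<zeta>\<bar> \<le> arcsin (tanh s) / 2"
  shows "norm (F (cis (pi / 4) * exp \<zeta>))
    \<le> C * exp (b * cosh s) * exp (b * exp (2 * Re \<zeta>) * cos (2 * Im \<zeta>))"
proof -
  define \<alpha> where "\<alpha> = arcsin (tanh s) / 2"
  note \<alpha> = gudermann_pos[OF pos(3), folded \<alpha>_def] gudermann_less[OF pos(3), folded \<alpha>_def]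
    sin_gudermann[OF pos(3), folded \<alpha>_def] cos_gudermann[OF pos(3), folded \<alpha>_def]
  \<comment> \<open>Logarithmic coordinates centred on a diagonal: \<open>Im \<zeta>\<close> is the
    angle to it, and the half-strip \<open>Re \<zeta> \<ge> 0\<close> becomes the part of the sector
    outside the open unit disc.\<close>
  define Z where "Z = (\<lambda>\<zeta>. cis (pi / 4) * exp \<zeta>)"
  have Z2: "(Z \<zeta>)\<^sup>2 = \<i> * exp (2 * \<zeta>)" for \<zeta>
    by (simp add: Z_def power_mult_distrib Complex.DeMoivre cis_pi_half flip: exp_of_nat_mult)
  have normZ: "(norm (Z \<zeta>))\<^sup>2 = exp (2 * Re \<zeta>)" for \<zeta>
    by (simp add: Z_def norm_mult flip: exp_of_nat_mult)
  have ReZ: "Re ((Z \<zeta>)\<^sup>2) = - exp (2 * Re \<zeta>) * sin (2 * Im \<zeta>)" for \<zeta>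
    by (simp add: Z2 Im_exp)
  \<comment> \<open>The divisor is the exponential of \<open>b\<close> times
    \<open>exp (2 * \<zeta>)\<close>, whose real part is \<open>Im (z\<^sup>2)\<close>; the desired
    estimate thus says that \<open>H\<close> is bounded.\<close>
  define H where "H = (\<lambda>\<zeta>. F (Z \<zeta>) * exp (- of_real b * exp (2 * \<zeta>)))"
  have normH: "norm (H \<zeta>) = norm (F (Z \<zeta>)) * exp (- b * exp (2 * Re \<zeta>) * cos (2 * Im \<zeta>))" for \<zeta>
    by (simp add: H_def norm_mult Re_exp mult_ac)
  have leH: "norm (H \<zeta>) \<le> C * exp (b * exp (2 * Re \<zeta>) * (cosh s - sinh s * \<bar>sin (2 * Im \<zeta>)\<bar> - cos (2 * Im \<zeta>)))" for \<zeta>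
  proof -
    have "norm (H \<zeta>) \<le> C * exp (b * (cosh s * (norm (Z \<zeta>))\<^sup>2 - sinh s * \<bar>Re ((Z \<zeta>)\<^sup>2)\<bar>)) * exp (- b * exp (2 * Re \<zeta>) * cos (2 * Im \<zeta>))"
      unfolding normH by (intro mult_right_mono bnd) auto
    also have "\<dots> = C * exp (b * exp (2 * Re \<zeta>) * (cosh s - sinh s * \<bar>sin (2 * Im \<zeta>)\<bar> - cos (2 * Im \<zeta>)))"
      unfolding normZ ReZ mult.assoc mult_exp_exp by (simp add: abs_mult) (simp add: algebra_simps)
    finally show ?thesis .
  qed
  have cos_nn: "cos (2 * Im \<zeta>) \<ge> 0" if "\<bar>Im \<zeta>\<bar> \<le> \<alpha>" for \<zeta>
    using that \<alpha> by (intro cos_ge_zero) auto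
  have sinh: "sinh s > 0" using pos by simp
  have growth: "norm (H \<zeta>) \<le> C * exp (b * cosh s * exp (2 * Re \<zeta>))" if "\<bar>Im \<zeta>\<bar> \<le> \<alpha>" for \<zeta>
  proof -
    have "exp (2 * Re \<zeta>) * (cosh s - sinh s * \<bar>sin (2 * Im \<zeta>)\<bar> - cos (2 * Im \<zeta>)) \<le> exp (2 * Re \<zeta>) * cosh s"
      using cos_nn[OF that] sinh by (intro mult_left_mono) (auto intro: order_trans[of _ 0])
    then have "b * exp (2 * Re \<zeta>) * (cosh s - sinh s * \<bar>sin (2 * Im \<zeta>)\<bar> - cos (2 * Im \<zeta>)) \<le> b * cosh s * exp (2 * Re \<zeta>)"
      using pos by (simp add: mult_ac)
    then show ?thesis using leH[of \<zeta>] pos by (elim order_trans) auto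
  qed
  have b1: "C \<le> C * exp (b * cosh s)" using pos by simp
  have "norm (H \<zeta>) \<le> C * exp (b * cosh s)"
  \<comment> \<open>Quadratic growth in \<open>z\<close> is rate 2 in \<open>\<zeta>\<close>, and
    \<open>\<alpha> < pi / 4\<close> is exactly the required subcriticality. The factor
    \<open>exp (b * cosh s)\<close> in the constant comes from the left edge, where
    \<open>norm z = 1\<close>.\<close>
  proof (rule phragmen_lindelof_half_strip[where H = H and \<sigma> = 2 and \<alpha> = \<alpha> and A = C and M = "b * cosh s"])
    show "H holomorphic_on UNIV"
    proof -
      have "Z holomorphic_on UNIV" unfolding Z_def by (intro holomorphic_intros)
      then have "(\<lambda>\<zeta>. F (Z \<zeta>)) holomorphic_on UNIV"
        using holomorphic_on_compose_gen[OF _ hol, of Z UNIV] by (simp add: o_def)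
      then show ?thesis unfolding H_def by (intro holomorphic_intros)
    qed
    show "norm (H z) \<le> C * exp (b * cosh s)" if "Re z = 0" "\<bar>Im z\<bar> \<le> \<alpha>" for z
      using growth[OF that(2)] that by simp
    show "norm (H z) \<le> C * exp (b * cosh s)" if "0 \<le> Re z" "\<bar>Im z\<bar> = \<alpha>" for z
    proof -
      have "Im z = \<alpha> \<or> Im z = - \<alpha>" using that by linarith
      then have sin_eq: "\<bar>sin (2 * Im z)\<bar> = \<bar>sin (2 * \<alpha>)\<bar>" and cos_eq: "cos (2 * Im z) = cos (2 * \<alpha>)"
        by auto
      have e: "\<bar>sin (2 * Im z)\<bar> = tanh s" "cos (2 * Im z) = 1 / cosh s"
        using \<alpha>(3,4) pos sin_eq cos_eq by simp_all
      have "cosh s - sinh s * tanh s - 1 / cosh s = 0"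
        using cosh_square_eq[of s] by (simp add: tanh_def field_simps power2_eq_square)
      then have "norm (H z) \<le> C" using leH[of z] by (simp add: e)
      then show ?thesis using b1 by simp
    qed
  qed (use \<alpha> growth pos \<zeta> in \<open>auto simp: \<alpha>_def\<close>)
  then have "norm (F (Z \<zeta>)) \<le> C * exp (b * cosh s) * exp (b * exp (2 * Re \<zeta>) * cos (2 * Im \<zeta>))"
    unfolding normH by (simp add: exp_minus field_simps)
  then show ?thesis by (simp add: Z_def)
qed

text \<open>
  Here \<open>k\<close> selects the quadrant and \<open>y\<close> is the angle to its diagonal; the hypothesis is invariant
  under multiplication of the argument by \<open>\<i>\<close>.
\<close>
lemma hardy_indicator_bound:
  fixes F :: "complex \<Rightarrow> complex"
  assumes hol: "F holomorphic_on UNIV" and pos: "C > 0" "b > 0" "s > 0"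
    and bnd: "\<And>z. norm (F z) \<le> C * exp (b * (cosh s * (norm z)\<^sup>2 - sinh s * \<bar>Re (z\<^sup>2)\<bar>))"
  shows "\<exists>\<kappa>>0. \<exists>C'>0. \<forall>r\<ge>0. \<forall>(k::nat) y. \<bar>y\<bar> \<le> pi / 4 \<longrightarrow>
    norm (F (of_real r * cis (pi / 4 + k * (pi / 2) + y))) \<le> C' * exp (b * r\<^sup>2 * (1 - \<kappa> * y\<^sup>2))"
proof -
  define \<alpha> where "\<alpha> = arcsin (tanh s) / 2"
  note \<alpha> = gudermann_pos[OF pos(3), folded \<alpha>_def] gudermann_less[OF pos(3), folded \<alpha>_def]
    sin_gudermann[OF pos(3), folded \<alpha>_def] cos_gudermann[OF pos(3), folded \<alpha>_def]
  have sc: "sinh s > 0" "cosh s > 1" using pos cosh_real_strict_mono[of 0 s] by auto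
  \<comment> \<open>The value \<open>1 / 2\<close> serves the cosine estimate inside the sector, and
    \<open>1 - 1 / cosh s\<close> serves the angles outside it, where
    \<open>y\<^sup>2 \<le> 1\<close>.\<close>
  define \<kappa> where "\<kappa> = min (1 / 2) (1 - 1 / cosh s)"
  have \<kappa>: "\<kappa> > 0" "\<kappa> \<le> 1 / 2" "1 / cosh s \<le> 1 - \<kappa>"
    using sc unfolding \<kappa>_def by (simp, linarith, linarith)
  define C' where "C' = C * exp (b * cosh s)"
  have CC': "C \<le> C'" "C' > 0" using pos sc by (auto simp: C'_def)
  have "norm (F (of_real r * cis (pi / 4 + k * (pi / 2) + y))) \<le> C' * exp (b * r\<^sup>2 * (1 - \<kappa> * y\<^sup>2))"
    if r: "r \<ge> 0" and y: "\<bar>y\<bar> \<le> pi / 4" for r y and k :: nat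
  proof -
    have "\<bar>y\<bar> \<le> 1" using y pi_less_4 by linarith
    then have y1: "y\<^sup>2 \<le> 1" by (simp add: abs_square_le_1)
    then have \<kappa>y: "\<kappa> * y\<^sup>2 \<le> \<kappa>" using \<kappa> by (simp add: mult_left_le)
    have \<kappa>y': "0 \<le> 1 - \<kappa> * y\<^sup>2" using \<kappa>y \<kappa> by linarith
    define c where "c = \<i> ^ k"
    have c: "c = cis (k * (pi / 2))"
      unfolding c_def by (metis Complex.DeMoivre cis_pi_half)
    have "c\<^sup>2 = (\<i>\<^sup>2) ^ k" by (simp only: c_def mult.commute flip: power_mult)
    then have c2: "c\<^sup>2 = 1 \<or> c\<^sup>2 = -1" by (cases "even k") simp_all
    have nc: "norm c = 1" by (simp add: c)
    define z where "z = of_real r * cis (pi / 4 + y)"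
    have cz: "of_real r * cis (pi / 4 + k * (pi / 2) + y) = c * z"
      by (simp add: c z_def cis_mult algebra_simps)
    have nz: "norm z = r" using r by (simp add: z_def norm_mult)
    have Rez: "Re (z\<^sup>2) = - r\<^sup>2 * sin (2 * y)"
      by (simp add: z_def power_mult_distrib Complex.DeMoivre distrib_left cos_add flip: of_real_power)
    have bndc: "norm (F (c * w)) \<le> C * exp (b * (cosh s * (norm w)\<^sup>2 - sinh s * \<bar>Re (w\<^sup>2)\<bar>))" for w
      using bnd[of "c * w"] c2 nc by (auto simp: norm_mult power_mult_distrib)
    have holc: "(\<lambda>w. F (c * w)) holomorphic_on UNIV"
      using holomorphic_on_compose_gen[OF _ hol, of "\<lambda>w. c * w" UNIV] by (simp add: o_def)
    \<comment> \<open>In the unit disc everything is absorbed by \<open>C'\<close>. Beyond the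
      critical angle the hypothesis itself is strong enough. The remaining region is the one reached
      by \<open>sector_bound\<close>.\<close>
    consider "r < 1" | "\<bar>y\<bar> > \<alpha>" | "r \<ge> 1" "\<bar>y\<bar> \<le> \<alpha>" by linarith
    then have "norm (F (c * z)) \<le> C' * exp (b * r\<^sup>2 * (1 - \<kappa> * y\<^sup>2))"
    proof cases
      case 1
      have "r\<^sup>2 \<le> 1" using 1 r by (simp add: power_le_one)
      then have "cosh s * r\<^sup>2 \<le> cosh s" using sc by simp
      moreover have "0 \<le> sinh s * \<bar>Re (z\<^sup>2)\<bar>" using sc by simp
      ultimately have "cosh s * r\<^sup>2 - sinh s * \<bar>Re (z\<^sup>2)\<bar> \<le> cosh s" by linarith
      then have "norm (F (c * z)) \<le> C'"
        using bndc[of z] pos unfolding C'_def nz by (elim order_trans) auto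
      moreover have "1 \<le> exp (b * r\<^sup>2 * (1 - \<kappa> * y\<^sup>2))"
        using \<kappa>y' pos by simp
      then have "C' * 1 \<le> C' * exp (b * r\<^sup>2 * (1 - \<kappa> * y\<^sup>2))"
        using CC' by (intro mult_left_mono) auto
      ultimately show ?thesis by simp
    next
      case 2
      have "sin (2 * \<alpha>) \<le> sin (2 * \<bar>y\<bar>)"
        using 2 \<alpha> y by (intro sin_monotone_2pi_le) auto
      also have "\<dots> \<le> \<bar>sin (2 * y)\<bar>" by (simp add: abs_if)
      finally have "sinh s * (r\<^sup>2 * tanh s) \<le> sinh s * \<bar>Re (z\<^sup>2)\<bar>"
        unfolding \<alpha> Rez using sc by (intro mult_left_mono) (auto simp: abs_mult intro: mult_left_mono)
      then have "cosh s * r\<^sup>2 - sinh s * \<bar>Re (z\<^sup>2)\<bar> \<le> r\<^sup>2 * (cosh s - sinh s * tanh s)"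
        by (simp add: algebra_simps)
      also have "cosh s - sinh s * tanh s = 1 / cosh s"
        using cosh_square_eq[of s] by (simp add: tanh_def field_simps power2_eq_square)
      also have "r\<^sup>2 * (1 / cosh s) \<le> r\<^sup>2 * (1 - \<kappa> * y\<^sup>2)"
        using \<kappa>(3) \<kappa>y by (intro mult_left_mono zero_le_power2) linarith
      finally have "b * (cosh s * r\<^sup>2 - sinh s * \<bar>Re (z\<^sup>2)\<bar>) \<le> b * (r\<^sup>2 * (1 - \<kappa> * y\<^sup>2))"
        using pos by simp
      then have "C * exp (b * (cosh s * r\<^sup>2 - sinh s * \<bar>Re (z\<^sup>2)\<bar>)) \<le> C' * exp (b * r\<^sup>2 * (1 - \<kappa> * y\<^sup>2))"
        using CC' pos by (intro mult_mono) (auto simp: mult_ac)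
      then show ?thesis using bndc[of z] unfolding nz by linarith
    next
      case 3
      define \<zeta> where "\<zeta> = Complex (ln r) y"
      have e: "exp \<zeta> = of_real r * cis y" using 3 by (simp add: \<zeta>_def exp_eq_polar)
      have "norm (F (c * (cis (pi / 4) * exp \<zeta>))) \<le> C' * exp (b * exp (2 * Re \<zeta>) * cos (2 * Im \<zeta>))"
        unfolding C'_def
        by (rule sector_bound[where F = "\<lambda>z. F (c * z)"])
           (use 3 pos bndc holc in \<open>auto simp: \<zeta>_def \<alpha>_def\<close>)
      also have "cis (pi / 4) * exp \<zeta> = z" by (simp add: e z_def cis_mult mult_ac add.commute)
      also have "exp (2 * Re \<zeta>) = r\<^sup>2" using 3 by (simp add: \<zeta>_def flip: ln_powr exp_of_nat_mult) 
      finally have *: "norm (F (c * z)) \<le> C' * exp (b * r\<^sup>2 * cos (2 * y))" by (simp add: \<zeta>_def)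
      \<comment> \<open>Through \<open>cos (2 * y) = 1 - 2 * (sin y)\<^sup>2\<close>, this linear
        lower bound for the sine yields the quadratic loss away from the diagonal.\<close>
      have "\<bar>y\<bar> / 2 \<le> sin \<bar>y\<bar>" using y by (intro half_le_sin) auto
      then have "(\<bar>y\<bar> / 2)\<^sup>2 \<le> (sin \<bar>y\<bar>)\<^sup>2" by (intro power_mono) auto
      also have "(sin \<bar>y\<bar>)\<^sup>2 = (sin y)\<^sup>2" by (simp add: abs_if)
      finally have "cos (2 * y) \<le> 1 - (1 / 2) * y\<^sup>2"
        by (simp add: cos_double_sin power_divide)
      also have "\<dots> \<le> 1 - \<kappa> * y\<^sup>2" using mult_right_mono[OF \<kappa>(2), of "y\<^sup>2"] by simp
      finally have "b * r\<^sup>2 * cos (2 * y) \<le> b * r\<^sup>2 * (1 - \<kappa> * y\<^sup>2)"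
        using pos by (intro mult_left_mono) auto
      then show ?thesis using * CC' by (elim order_trans) auto
    qed
    then show ?thesis unfolding cz .
  qed
  then show ?thesis using \<kappa> CC' by blast
qed

section \<open>The Bargmann transform\<close>

lemma hermite_recurrence_deriv:
  fixes x z :: complex
  defines "K \<equiv> \<lambda>z. exp (2 * x * z - z\<^sup>2)"
  shows "(deriv ^^ Suc (Suc n)) K z
    = (2 * x - 2 * z) * (deriv ^^ Suc n) K z - 2 * of_nat (Suc n) * (deriv ^^ n) K z"
proof -
  have hol: "(deriv ^^ n) K holomorphic_on UNIV" for n
    by (intro holomorphic_higher_deriv) (auto simp: K_def intro!: holomorphic_intros)
  have D: "((deriv ^^ n) K has_field_derivative (deriv ^^ Suc n) K z) (at z)" for n z
    using holomorphic_derivI[OF hol open_UNIV, of z n] by simp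
  have D1: "(deriv ^^ Suc 0) K z = (2 * x - 2 * z) * K z" for z
  proof -
    have "(K has_field_derivative (2 * x - 2 * z) * K z) (at z)"
      unfolding K_def by (auto intro!: derivative_eq_intros)
    then show ?thesis by (simp add: DERIV_imp_deriv)
  qed
  \<comment> \<open>Induction by differentiating the identity: it starts from
    \<open>K' = (2 * x - 2 * z) * K\<close>, and each differentiation of the linear factor
    contributes another \<open>-2\<close>, which raises the last coefficient by one step.\<close>
  show ?thesis
  proof (induction n arbitrary: z)
    case 0
    have "((\<lambda>z. (2 * x - 2 * z) * K z) has_field_derivative
        (2 * x - 2 * z) * (deriv ^^ Suc 0) K z - 2 * K z) (at z)"
      using D[of 0 z] by (auto intro!: derivative_eq_intros)
    then have "((deriv ^^ Suc 0) K has_field_derivative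
        (2 * x - 2 * z) * (deriv ^^ Suc 0) K z - 2 * K z) (at z)"
      by (subst ext[OF D1])
    then show ?case using DERIV_unique[OF D[of "Suc 0" z]] by simp
  next
    case (Suc n)
    have "((\<lambda>z. (2 * x - 2 * z) * (deriv ^^ Suc n) K z - 2 * of_nat (Suc n) * (deriv ^^ n) K z)
       has_field_derivative (2 * x - 2 * z) * (deriv ^^ Suc (Suc n)) K z - 2 * (deriv ^^ Suc n) K z
         - 2 * of_nat (Suc n) * (deriv ^^ Suc n) K z) (at z)"
      by (rule derivative_eq_intros D refl)+ simp
    then have "((deriv ^^ Suc (Suc n)) K has_field_derivative
       (2 * x - 2 * z) * (deriv ^^ Suc (Suc n)) K z - 2 * (deriv ^^ Suc n) K z
         - 2 * of_nat (Suc n) * (deriv ^^ Suc n) K z) (at z)"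
      by (subst ext[OF Suc.IH])
    from DERIV_unique[OF D[of "Suc (Suc n)" z] this] show ?case
      by (simp del: funpow.simps add: algebra_simps)
  qed
qed

text \<open>At \<open>z = 0\<close> the recurrence for the derivatives loses its \<open>z\<close>
  term and becomes the defining three-term recurrence of the polynomials.\<close>

lemma hermite_poly_eq_deriv:
  "(deriv ^^ n) (\<lambda>z. exp (2 * complex_of_real x * z - z\<^sup>2)) 0 = complex_of_real (hermite_poly n x)"
proof (induction n x rule: hermite_poly.induct)
  case (2 x)
  have "((\<lambda>z. exp (2 * complex_of_real x * z - z\<^sup>2)) has_field_derivative 2 * of_real x) (at 0)"
    by (auto intro!: derivative_eq_intros)
  then show ?case by (simp add: DERIV_imp_deriv)
next
  case (3 n x)
  then show ?case
    by (simp del: funpow.simps add: hermite_recurrence_deriv)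
qed simp

lemma hermite_poly_sums:
  "(\<lambda>n. complex_of_real (hermite_poly n x) / fact n * z ^ n) sums exp (2 * complex_of_real x * z - z\<^sup>2)"
proof -
  have "(\<lambda>n. (deriv ^^ n) (\<lambda>z. exp (2 * complex_of_real x * z - z\<^sup>2)) 0 / fact n * (z - 0) ^ n)
      sums exp (2 * complex_of_real x * z - z\<^sup>2)"
    by (rule holomorphic_power_series[where r = "norm z + 1"]) (auto intro!: holomorphic_intros)
  then show ?thesis by (simp add: hermite_poly_eq_deriv)
qed

text \<open>Cauchy's inequality for the generating function on the circle of radius \<rho>. Leaving
  \<rho> free later allows geometric decay at any prescribed rate.\<close>

lemma hermite_poly_bound:
  assumes "\<rho> > 0"
  shows "\<bar>hermite_poly n x\<bar> \<le> fact n * exp (2 * \<bar>x\<bar> * \<rho> + \<rho>\<^sup>2) / \<rho> ^ n"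
proof -
  have "norm ((deriv ^^ n) (\<lambda>z. exp (2 * complex_of_real x * z - z\<^sup>2)) 0)
      \<le> fact n * exp (2 * \<bar>x\<bar> * \<rho> + \<rho>\<^sup>2) / \<rho> ^ n"
  proof (rule Cauchy_inequality)
    fix z :: complex
    assume "norm (0 - z) = \<rho>"
    then have nz: "norm z = \<rho>" by simp
    have "Re (2 * complex_of_real x * z - z\<^sup>2) \<le> norm (2 * complex_of_real x * z - z\<^sup>2)"
      by (rule complex_Re_le_cmod)
    also have "\<dots> \<le> norm (2 * complex_of_real x * z) + norm (z\<^sup>2)" by (rule norm_triangle_ineq4)
    also have "\<dots> = 2 * \<bar>x\<bar> * \<rho> + \<rho>\<^sup>2" by (simp add: norm_mult norm_power nz)
    finally show "norm (exp (2 * complex_of_real x * z - z\<^sup>2)) \<le> exp (2 * \<bar>x\<bar> * \<rho> + \<rho>\<^sup>2)"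
      unfolding norm_exp_eq_Re by simp
  qed (use assms in \<open>auto intro!: holomorphic_intros holomorphic_on_imp_continuous_on\<close>)
  then show ?thesis by (simp add: hermite_poly_eq_deriv)
qed

lemma hermite_fun_normalized:
  "hermite_fun n x * sqrt (sqrt pi) / sqrt (fact n) = exp (- (x\<^sup>2 / 2)) * (hermite_poly n x / fact n / sqrt 2 ^ n)"
proof -
  have "sqrt (2 ^ n * fact n * sqrt pi) = sqrt 2 ^ n * sqrt (fact n) * sqrt (sqrt pi)"
    by (simp add: real_sqrt_mult real_sqrt_power)
  moreover have "sqrt (fact n) * sqrt (fact n) = (fact n :: real)" by simp
  ultimately show ?thesis
    unfolding hermite_fun_def by (simp add: divide_simps)
qed

section \<open>Gaussian integrals\<close>

lemma
  fixes A \<beta> :: real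
  assumes "A > 0"
  shows integrable_exp_quadratic: "integrable lborel (\<lambda>x. exp (\<beta> * x - A * x\<^sup>2 / 2))"
    and integral_exp_quadratic: "(LINT x|lborel. exp (\<beta> * x - A * x\<^sup>2 / 2)) = sqrt (2 * pi / A) * exp (\<beta>\<^sup>2 / (2 * A))"
proof -
  \<comment> \<open>Completing the square exhibits a multiple of the normal density with mean
    \<open>\<beta> / A\<close> and standard deviation \<open>1 / sqrt A\<close>.\<close>
  have eq: "(\<lambda>x. exp (\<beta> * x - A * x\<^sup>2 / 2))
      = (\<lambda>x. sqrt (2 * pi / A) * exp (\<beta>\<^sup>2 / (2 * A)) * normal_density (\<beta> / A) (1 / sqrt A) x)"
  proof
    fix x
    have e: "exp (\<beta>\<^sup>2 / (2 * A)) * exp (- ((x - \<beta> / A)\<^sup>2 * A / 2)) = exp (\<beta> * x - A * x\<^sup>2 / 2)"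
      unfolding mult_exp_exp using assms
      by (simp add: field_simps power2_eq_square)
    have "sqrt (2 * pi / A) * exp (\<beta>\<^sup>2 / (2 * A)) * normal_density (\<beta> / A) (1 / sqrt A) x
       = exp (\<beta>\<^sup>2 / (2 * A)) * exp (- ((x - \<beta> / A)\<^sup>2 * A / 2))"
      using assms by (simp add: normal_density_def power_divide real_sqrt_divide real_sqrt_mult)
    then show "exp (\<beta> * x - A * x\<^sup>2 / 2) = sqrt (2 * pi / A) * exp (\<beta>\<^sup>2 / (2 * A)) * normal_density (\<beta> / A) (1 / sqrt A) x"
      using e by simp
  qed
  show "integrable lborel (\<lambda>x. exp (\<beta> * x - A * x\<^sup>2 / 2))"
    unfolding eq using assms by (intro integrable_mult_right integrable_normal_density) simp
  show "(LINT x|lborel. exp (\<beta> * x - A * x\<^sup>2 / 2)) = sqrt (2 * pi / A) * exp (\<beta>\<^sup>2 / (2 * A))"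
    unfolding eq using assms by (subst integral_mult_right_zero) simp
qed

text \<open>A real translation by \<open>Re W\<close> removes the real part of the linear term. What
  remains is the characteristic function of the standard normal distribution at
  \<open>Im W\<close>.\<close>

lemma integral_exp_complex_quadratic:
  fixes W :: complex
  shows "(LINT x|lborel. exp (W * of_real x - (of_real x)\<^sup>2 / 2)) = sqrt (2 * pi) * exp (W\<^sup>2 / 2)"
proof -
  define u v where "u = Re W" and "v = Im W"
  have W: "W = of_real u + \<i> * of_real v" by (simp add: u_def v_def complex_eq)
  have "(LINT x|lborel. exp (W * of_real x - (of_real x)\<^sup>2 / 2))
      = (LINT x|lborel. exp (W * of_real (u + 1 * x) - (of_real (u + 1 * x))\<^sup>2 / 2))"
    by (subst lborel_integral_real_affine[where c = 1 and t = u]) simp_all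
  also have "(\<lambda>x. exp (W * of_real (u + 1 * x) - (of_real (u + 1 * x))\<^sup>2 / 2))
      = (\<lambda>x. sqrt (2 * pi) * exp ((of_real u)\<^sup>2 / 2 + \<i> * of_real u * of_real v)
           * (std_normal_density x *\<^sub>R exp (\<i> * of_real (v * x))))"
  proof
    fix x :: real
    have "W * of_real (u + 1 * x) - (of_real (u + 1 * x))\<^sup>2 / 2
        = ((of_real u)\<^sup>2 / 2 + \<i> * of_real u * of_real v) + (- ((of_real x)\<^sup>2 / 2) + \<i> * of_real (v * x))"
      by (simp add: W power2_eq_square field_simps)
    then show "exp (W * of_real (u + 1 * x) - (of_real (u + 1 * x))\<^sup>2 / 2)
        = sqrt (2 * pi) * exp ((of_real u)\<^sup>2 / 2 + \<i> * of_real u * of_real v)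
           * (std_normal_density x *\<^sub>R exp (\<i> * of_real (v * x)))"
      by (simp only: exp_add) (simp add: std_normal_density_def scaleR_conv_of_real flip: exp_of_real)
  qed
  also have "(LINT x|lborel. sqrt (2 * pi) * exp ((of_real u)\<^sup>2 / 2 + \<i> * of_real u * of_real v)
           * (std_normal_density x *\<^sub>R exp (\<i> * of_real (v * x))))
     = sqrt (2 * pi) * exp ((of_real u)\<^sup>2 / 2 + \<i> * of_real u * of_real v) * char std_normal_distribution v"
    unfolding char_def by (subst integral_mult_right_zero, subst integral_density) auto
  also have "\<dots> = sqrt (2 * pi) * exp (W\<^sup>2 / 2)"
  proof -
    have "(of_real u)\<^sup>2 / 2 + \<i> * of_real u * of_real v + - ((of_real v)\<^sup>2 / 2) = W\<^sup>2 / 2"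
      by (simp add: W power2_eq_square field_simps)
    then have "exp ((of_real u)\<^sup>2 / 2 + \<i> * of_real u * of_real v) * exp (- ((of_real v)\<^sup>2 / 2)) = exp (W\<^sup>2 / 2)"
      by (simp only: mult_exp_exp)
    then show ?thesis by (simp add: char_std_normal_distribution flip: exp_of_real)
  qed
  finally show ?thesis .
qed

section \<open>The Bargmann kernel and its expansion\<close>

definition bargmann_kernel :: "complex \<Rightarrow> real \<Rightarrow> complex" where
  "bargmann_kernel z x = exp (complex_of_real (sqrt 2 * x) * z - ((complex_of_real x)\<^sup>2 + z\<^sup>2) / 2)"

definition bargmann :: "(real \<Rightarrow> complex) \<Rightarrow> complex \<Rightarrow> complex" where
  "bargmann f z = (LINT x|lborel. f x * bargmann_kernel z x)"

lemma bargmann_kernel_measurable [measurable]: "bargmann_kernel z \<in> borel_measurable borel"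
  unfolding bargmann_kernel_def by measurable

lemma norm_bargmann_kernel:
  "norm (bargmann_kernel z x) = exp (((Im z)\<^sup>2 - (Re z)\<^sup>2) / 2) * exp (sqrt 2 * Re z * x - x\<^sup>2 / 2)"
  unfolding bargmann_kernel_def norm_exp_eq_Re mult_exp_exp
  by (simp add: Re_power2 field_simps)

lemma integrable_bargmann_kernel: "integrable lborel (bargmann_kernel z)"
proof (rule Bochner_Integration.integrable_bound)
  show "integrable lborel (\<lambda>x. exp (((Im z)\<^sup>2 - (Re z)\<^sup>2) / 2) * exp (sqrt 2 * Re z * x - 1 * x\<^sup>2 / 2))"
    by (intro integrable_mult_right integrable_exp_quadratic) simp
qed (auto simp: norm_bargmann_kernel)

text \<open>Substitute \<open>z / sqrt 2\<close> in the Hermite generating function and multiply by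
  the Gaussian. The kernel omits the classical factor \<open>pi powr (-1/4)\<close>, which therefore
  reappears inverted as \<open>sqrt (sqrt pi)\<close> in the coefficients.\<close>

lemma bargmann_kernel_sums:
  "(\<lambda>n. complex_of_real (hermite_fun n x * sqrt (sqrt pi) / sqrt (fact n)) * z ^ n) sums bargmann_kernel z x"
proof -
  have s2: "(complex_of_real (sqrt 2))\<^sup>2 = 2" by (simp flip: of_real_power)
  have "(\<lambda>n. exp (- ((of_real x)\<^sup>2 / 2)) * (complex_of_real (hermite_poly n x) / fact n * (z / of_real (sqrt 2)) ^ n))
    sums (exp (- ((of_real x)\<^sup>2 / 2)) * exp (2 * complex_of_real x * (z / of_real (sqrt 2)) - (z / of_real (sqrt 2))\<^sup>2))"
    by (intro sums_mult hermite_poly_sums)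
  also have "exp (- ((of_real x)\<^sup>2 / 2)) * exp (2 * complex_of_real x * (z / of_real (sqrt 2)) - (z / of_real (sqrt 2))\<^sup>2)
      = bargmann_kernel z x"
  proof -
    have "2 * complex_of_real x * (z / of_real (sqrt 2)) = complex_of_real (sqrt 2 * x) * z"
      using s2 by (simp add: field_simps power2_eq_square)
    then show ?thesis
      unfolding bargmann_kernel_def mult_exp_exp power_divide s2
      by (intro arg_cong[of _ _ exp]) (simp add: add_divide_distrib)
  qed
  also have "(\<lambda>n. exp (- ((of_real x)\<^sup>2 / 2)) * (complex_of_real (hermite_poly n x) / fact n * (z / of_real (sqrt 2)) ^ n))
     = (\<lambda>n. complex_of_real (hermite_fun n x * sqrt (sqrt pi) / sqrt (fact n)) * z ^ n)"
  proof
    fix n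
    show "exp (- ((of_real x)\<^sup>2 / 2)) * (complex_of_real (hermite_poly n x) / fact n * (z / of_real (sqrt 2)) ^ n)
      = complex_of_real (hermite_fun n x * sqrt (sqrt pi) / sqrt (fact n)) * z ^ n"
      by (simp add: hermite_fun_normalized power_divide flip: exp_of_real)
  qed
  finally show ?thesis .
qed

lemma hermite_poly_measurable [measurable]: "hermite_poly n \<in> borel_measurable borel"
proof (induction n rule: less_induct)
  case (less n)
  consider "n = 0" | "n = 1" | m where "n = Suc (Suc m)" by (metis One_nat_def not0_implies_Suc)
  then show ?case
  proof cases
    case 3
    then have [measurable]: "hermite_poly (Suc m) \<in> borel_measurable borel" "hermite_poly m \<in> borel_measurable borel"
      using less by auto
    show ?thesis unfolding 3 hermite_poly.simps[abs_def] by measurable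
  qed (simp_all add: hermite_poly.simps[abs_def])
qed

lemma hermite_fun_measurable [measurable]: "hermite_fun n \<in> borel_measurable borel"
  unfolding hermite_fun_def by measurable

text \<open>The Gaussian absorbs the factor \<open>exp (2 * \<bar>x\<bar> * \<rho>)\<close>, so the
  bound is uniform in \<open>x\<close>. This uniformity is what permits integrating the kernel
  expansion term by term against any integrable \<open>f\<close>.\<close>

lemma hermite_fun_bound:
  assumes "\<rho> > 0"
  shows "\<bar>hermite_fun n x * sqrt (sqrt pi) / sqrt (fact n)\<bar> \<le> exp (3 * \<rho>\<^sup>2) / (sqrt 2 * \<rho>) ^ n"
proof -
  have "\<bar>hermite_fun n x * sqrt (sqrt pi) / sqrt (fact n)\<bar>
      = exp (- (x\<^sup>2 / 2)) * (\<bar>hermite_poly n x\<bar> / fact n / sqrt 2 ^ n)"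
    by (simp add: hermite_fun_normalized abs_mult)
  also have "\<dots> \<le> exp (- (x\<^sup>2 / 2)) * (fact n * exp (2 * \<bar>x\<bar> * \<rho> + \<rho>\<^sup>2) / \<rho> ^ n / fact n / sqrt 2 ^ n)"
    by (intro mult_left_mono divide_right_mono hermite_poly_bound assms) auto
  also have "\<dots> = exp (- (x\<^sup>2 / 2)) * exp (2 * \<bar>x\<bar> * \<rho> + \<rho>\<^sup>2) / (sqrt 2 * \<rho>) ^ n"
    by (simp add: power_mult_distrib mult_ac)
  also have "\<dots> \<le> exp (3 * \<rho>\<^sup>2) / (sqrt 2 * \<rho>) ^ n"
  proof -
    have "0 \<le> (\<bar>x\<bar> - 2 * \<rho>)\<^sup>2" by simp
    then have "- (x\<^sup>2 / 2) + (2 * \<bar>x\<bar> * \<rho> + \<rho>\<^sup>2) \<le> 3 * \<rho>\<^sup>2"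
      by (simp add: power2_diff power_mult_distrib)
    then show ?thesis unfolding mult_exp_exp using assms by (intro divide_right_mono) auto
  qed
  finally show ?thesis .
qed

lemma bargmann_sums:
  assumes "integrable lborel f"
  shows "(\<lambda>n. hermite_coeff f n * of_real (sqrt (sqrt pi) / sqrt (fact n)) * z ^ n) sums bargmann f z"
proof -
  \<comment> \<open>With this choice \<open>sqrt 2 * \<rho>\<close> exceeds \<open>norm z\<close>,
    so the terms of the expansion are dominated by a geometric series of ratio
    \<open>q < 1\<close>.\<close>
  define \<rho> where "\<rho> = sqrt 2 * norm z + 1"
  have \<rho>: "\<rho> > 0" by (simp add: \<rho>_def add_nonneg_pos)
  define q where "q = norm z / (sqrt 2 * \<rho>)"
  have q: "0 \<le> q" "q < 1"
    using \<rho> by (auto simp: q_def divide_simps) (simp add: \<rho>_def algebra_simps add_nonneg_pos)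
  define g where "g = (\<lambda>n x. f x * (of_real (hermite_fun n x * sqrt (sqrt pi) / sqrt (fact n)) * z ^ n))"
  have [measurable]: "f \<in> borel_measurable borel" using assms by (simp add: borel_measurable_integrable)
  have gm [measurable]: "g n \<in> borel_measurable borel" for n unfolding g_def by measurable
  have gb: "norm (g n x) \<le> exp (3 * \<rho>\<^sup>2) * q ^ n * norm (f x)" for n x
  proof -
    have "norm (g n x) = norm (f x) * (\<bar>hermite_fun n x * sqrt (sqrt pi) / sqrt (fact n)\<bar> * norm z ^ n)"
      unfolding g_def norm_mult norm_of_real norm_power ..
    also have "\<dots> \<le> norm (f x) * (exp (3 * \<rho>\<^sup>2) / (sqrt 2 * \<rho>) ^ n * norm z ^ n)"
      by (intro mult_left_mono mult_right_mono hermite_fun_bound \<rho>) auto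
    finally show ?thesis by (simp add: q_def power_divide mult_ac)
  qed
  have fi: "integrable lborel (\<lambda>x. exp (3 * \<rho>\<^sup>2) * q ^ n * norm (f x))" for n
    using assms by (intro integrable_mult_right integrable_norm)
  have gi: "integrable lborel (g n)" for n
    by (rule Bochner_Integration.integrable_bound[OF fi[of n]])
       (use gb q in \<open>auto simp: abs_mult intro: order_trans\<close>)
  have sq: "summable (\<lambda>n. q ^ n)" using q by (intro summable_geometric) auto
  have "(\<lambda>n. integral\<^sup>L lborel (g n)) sums (\<integral>x. (\<Sum>n. g n x) \<partial>lborel)"
  proof (rule sums_integral)
    show "AE x in lborel. summable (\<lambda>n. norm (g n x))"
    proof (rule AE_I2)
      fix x
      have "summable (\<lambda>n. exp (3 * \<rho>\<^sup>2) * q ^ n * norm (f x))"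
        by (intro summable_mult2 summable_mult sq)
      then show "summable (\<lambda>n. norm (g n x))" by (rule summable_comparison_test'[where N = 0]) (simp add: gb)
    qed
    have "summable (\<lambda>n. exp (3 * \<rho>\<^sup>2) * q ^ n * (LINT x|lborel. norm (f x)))"
      by (intro summable_mult2 summable_mult sq)
    then show "summable (\<lambda>n. LINT x|lborel. norm (g n x))"
    proof (rule summable_comparison_test'[where N = 0])
      fix n
      have "(LINT x|lborel. norm (g n x)) \<le> (LINT x|lborel. exp (3 * \<rho>\<^sup>2) * q ^ n * norm (f x))"
        by (intro integral_mono integrable_norm gi fi gb)
      then show "norm (LINT x|lborel. norm (g n x)) \<le> exp (3 * \<rho>\<^sup>2) * q ^ n * (LINT x|lborel. norm (f x))"
        by simp
    qed
  qed (rule gi)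
  moreover have "(\<Sum>n. g n x) = f x * bargmann_kernel z x" for x
    using sums_mult[OF bargmann_kernel_sums, of "f x" x z] by (simp add: g_def sums_iff)
  moreover have "integral\<^sup>L lborel (g n) = hermite_coeff f n * of_real (sqrt (sqrt pi) / sqrt (fact n)) * z ^ n" for n
  proof -
    have "g n = (\<lambda>x. f x * cnj (complex_of_real (hermite_fun n x)) * (of_real (sqrt (sqrt pi) / sqrt (fact n)) * z ^ n))"
      by (auto simp: g_def)
    then have "integral\<^sup>L lborel (g n) = hermite_coeff f n * (of_real (sqrt (sqrt pi) / sqrt (fact n)) * z ^ n)"
      unfolding hermite_coeff_def by (simp only: integral_mult_left_zero)
    then show ?thesis by (simp only: mult.assoc)
  qed
  ultimately show ?thesis by (simp add: bargmann_def)
qed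

lemma holomorphic_bargmann:
  assumes "integrable lborel f"
  shows "bargmann f holomorphic_on UNIV"
proof -
  have "bargmann f holomorphic_on ball 0 r" for r
    by (rule power_series_holomorphic[where a = "\<lambda>n. hermite_coeff f n * of_real (sqrt (sqrt pi) / sqrt (fact n))"])
       (use bargmann_sums[OF assms] in simp)
  then have "bargmann f holomorphic_on (\<Union>r. ball 0 r)"
    by (intro holomorphic_on_UN_open) auto
  moreover have "(\<Union>r. ball (0::complex) r) = UNIV"
    by (auto intro: gt_ex)
  ultimately show ?thesis by simp
qed

section \<open>Growth of the transform from decay of the function and of its Fourier
  transform\<close>

lemma norm_bargmann_le:
  assumes [measurable]: "f \<in> borel_measurable borel" and a: "a > -1"
    and bnd: "\<And>x. norm (f x) \<le> C * gauss a x"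
  shows "norm (bargmann f z)
    \<le> C * sqrt (2 * pi / (1 + a)) * exp (((1 - a) / (1 + a) * (Re z)\<^sup>2 + (Im z)\<^sup>2) / 2)"
proof -
  define E where "E = exp (((Im z)\<^sup>2 - (Re z)\<^sup>2) / 2)"
  have i: "integrable lborel (\<lambda>x. C * E * exp (sqrt 2 * Re z * x - (1 + a) * x\<^sup>2 / 2))"
    using a by (intro integrable_mult_right integrable_exp_quadratic) simp
  have b: "norm (f x * bargmann_kernel z x) \<le> C * E * exp (sqrt 2 * Re z * x - (1 + a) * x\<^sup>2 / 2)" for x
  proof -
    have "norm (f x * bargmann_kernel z x) \<le> (C * gauss a x) * (E * exp (sqrt 2 * Re z * x - x\<^sup>2 / 2))"
      unfolding norm_mult norm_bargmann_kernel E_def by (intro mult_right_mono bnd) auto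
    also have "\<dots> = C * E * (exp (- a * x\<^sup>2 / 2) * exp (sqrt 2 * Re z * x - x\<^sup>2 / 2))"
      by (simp add: gauss_def)
    also have "\<dots> = C * E * exp (sqrt 2 * Re z * x - (1 + a) * x\<^sup>2 / 2)"
      unfolding mult_exp_exp by (simp add: field_simps)
    finally show ?thesis .
  qed
  have "norm (bargmann f z) \<le> (LINT x|lborel. C * E * exp (sqrt 2 * Re z * x - (1 + a) * x\<^sup>2 / 2))"
    unfolding bargmann_def
  proof (rule Bochner_Integration.integral_norm_bound_integral[OF _ i b])
    show "integrable lborel (\<lambda>x. f x * bargmann_kernel z x)"
      by (rule Bochner_Integration.integrable_bound[OF i]) (auto intro!: AE_I2 order_trans[OF b abs_ge_self])
  qed
  also have "\<dots> = C * E * (sqrt (2 * pi / (1 + a)) * exp ((sqrt 2 * Re z)\<^sup>2 / (2 * (1 + a))))"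
    using a by (subst integral_mult_right_zero, subst integral_exp_quadratic) auto
  also have "\<dots> = C * sqrt (2 * pi / (1 + a)) * (E * exp ((sqrt 2 * Re z)\<^sup>2 / (2 * (1 + a))))" by simp
  \<comment> \<open>The coefficient of \<open>(Re z)\<^sup>2\<close> is
    \<open>1 / (1 + a) - 1 / 2\<close>, half of \<open>(1 - a) / (1 + a)\<close>. Decay of
    \<open>f\<close> thus improves growth in the real direction only.\<close>
  also have "E * exp ((sqrt 2 * Re z)\<^sup>2 / (2 * (1 + a))) = exp (((1 - a) / (1 + a) * (Re z)\<^sup>2 + (Im z)\<^sup>2) / 2)"
    unfolding E_def mult_exp_exp using a by (simp add: field_simps power_mult_distrib)
  finally show ?thesis .
qed

text \<open>Since \<open>(\<i> * z)\<^sup>2 = - z\<^sup>2\<close>, the integrand is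
  \<open>exp (z\<^sup>2 / 2)\<close> times a complex Gaussian with linear coefficient
  \<open>W\<close>, and adding \<open>W\<^sup>2 / 2\<close> restores the exponent of the kernel at
  \<open>z\<close>.\<close>

lemma fourier_bargmann_kernel:
  "(LINT \<xi>|lborel. exp (- \<i> * of_real (\<xi> * x)) * bargmann_kernel (\<i> * z) \<xi>)
    = sqrt (2 * pi) * bargmann_kernel z x"
proof -
  define W where "W = \<i> * (of_real (sqrt 2) * z - of_real x)"
  have s2: "(complex_of_real (sqrt 2))\<^sup>2 = 2" by (simp flip: of_real_power)
  have W2: "W\<^sup>2 = - 2 * z\<^sup>2 + 2 * of_real (sqrt 2 * x) * z - (of_real x)\<^sup>2"
    using s2 by (simp add: W_def power_mult_distrib power2_diff algebra_simps)
  have "(\<lambda>\<xi>. exp (- \<i> * of_real (\<xi> * x)) * bargmann_kernel (\<i> * z) \<xi>)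
      = (\<lambda>\<xi>. exp (z\<^sup>2 / 2) * exp (W * of_real \<xi> - (of_real \<xi>)\<^sup>2 / 2))"
    unfolding bargmann_kernel_def mult_exp_exp
    by (rule ext, rule arg_cong[of _ _ exp]) (simp add: W_def power_mult_distrib field_simps)
  then have "(LINT \<xi>|lborel. exp (- \<i> * of_real (\<xi> * x)) * bargmann_kernel (\<i> * z) \<xi>)
      = exp (z\<^sup>2 / 2) * (sqrt (2 * pi) * exp (W\<^sup>2 / 2))"
    by (simp only: integral_mult_right_zero integral_exp_complex_quadratic)
  also have "\<dots> = sqrt (2 * pi) * (exp (z\<^sup>2 / 2) * exp (W\<^sup>2 / 2))" by simp
  also have "exp (z\<^sup>2 / 2) * exp (W\<^sup>2 / 2) = bargmann_kernel z x"
    unfolding bargmann_kernel_def mult_exp_exp W2 by (rule arg_cong[of _ _ exp]) (simp add: field_simps)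
  finally show ?thesis .
qed

text \<open>Fubini moves the Fourier transform onto the kernel, where it acts as a quarter turn of
  \<open>z\<close>. Decay of \<open>fourier f\<close> therefore gives the growth bound with the two
  axes exchanged.\<close>

lemma
  assumes f: "integrable lborel f"
  shows fourier_measurable: "fourier f \<in> borel_measurable borel"
    and bargmann_fourier: "bargmann (fourier f) (\<i> * z) = bargmann f z"
proof -
  have [measurable]: "f \<in> borel_measurable borel" using f by (simp add: borel_measurable_integrable)
  show "fourier f \<in> borel_measurable borel"
    unfolding fourier_def by measurable
  define c where "c = complex_of_real (1 / sqrt (2 * pi))"
  define g where "g = (\<lambda>x \<xi>. f x * (exp (- \<i> * of_real (\<xi> * x)) * bargmann_kernel (\<i> * z) \<xi>))"
  have ng: "norm (g x \<xi>) = norm (f x) * norm (bargmann_kernel (\<i> * z) \<xi>)" for x \<xi>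
    by (simp add: g_def norm_mult)
  have "integrable (lborel \<Otimes>\<^sub>M lborel) (case_prod g)"
  proof (rule lborel_pair.Fubini_integrable)
    show "case_prod g \<in> borel_measurable (lborel \<Otimes>\<^sub>M lborel)" unfolding g_def by measurable
    show "integrable lborel (\<lambda>x. LINT y|lborel. norm (case (x, y) of (x, \<xi>) \<Rightarrow> g x \<xi>))"
      unfolding prod.case ng integral_mult_right_zero by (intro integrable_mult_left integrable_norm f)
    show "AE x in lborel. integrable lborel (\<lambda>y. case (x, y) of (x, \<xi>) \<Rightarrow> g x \<xi>)"
    proof (rule AE_I2)
      fix x
      show "integrable lborel (\<lambda>y. case (x, y) of (x, \<xi>) \<Rightarrow> g x \<xi>)"
      proof (rule Bochner_Integration.integrable_bound)
        show "integrable lborel (\<lambda>\<xi>. norm (f x) * norm (bargmann_kernel (\<i> * z) \<xi>))"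
          by (intro integrable_mult_right integrable_norm integrable_bargmann_kernel)
        show "(\<lambda>y. case (x, y) of (x, \<xi>) \<Rightarrow> g x \<xi>) \<in> borel_measurable lborel"
          unfolding g_def prod.case by measurable
      qed (simp add: ng)
    qed
  qed
  then have "(LINT \<xi>|lborel. LINT x|lborel. g x \<xi>) = (LINT x|lborel. LINT \<xi>|lborel. g x \<xi>)"
    by (rule lborel_pair.Fubini_integral)
  moreover have "(LINT x|lborel. g x \<xi>) = sqrt (2 * pi) * (fourier f \<xi> * bargmann_kernel (\<i> * z) \<xi>)" for \<xi>
  proof -
    have "(\<lambda>x. g x \<xi>) = (\<lambda>x. f x * exp (- \<i> * of_real (\<xi> * x)) * bargmann_kernel (\<i> * z) \<xi>)"
      by (simp add: g_def mult.assoc)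
    then show ?thesis unfolding fourier_def by (simp add: integral_mult_left_zero)
  qed
  moreover have "(LINT \<xi>|lborel. g x \<xi>) = sqrt (2 * pi) * (f x * bargmann_kernel z x)" for x
    unfolding g_def integral_mult_right_zero fourier_bargmann_kernel by simp
  ultimately have "complex_of_real (sqrt (2 * pi)) * bargmann (fourier f) (\<i> * z) = sqrt (2 * pi) * bargmann f z"
    unfolding bargmann_def by simp
  then show "bargmann (fourier f) (\<i> * z) = bargmann f z" by simp
qed

text \<open>For \<open>a = tanh s\<close> the ratio \<open>(1 - a) / (1 + a)\<close> is
  \<open>exp (- 2 * s)\<close>. The bound from \<open>f\<close> is used where
  \<open>Re (z\<^sup>2) \<ge> 0\<close> and the one from \<open>fourier f\<close> elsewhere, which
  produces the absolute value.\<close>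

lemma hardy_class_bargmann_bound:
  assumes s: "s > 0" and f: "f \<in> hardy_class (tanh s)"
  shows "\<exists>C>0. \<forall>z. norm (bargmann f z)
    \<le> C * exp (exp (- s) / 2 * (cosh s * (norm z)\<^sup>2 - sinh s * \<bar>Re (z\<^sup>2)\<bar>))"
proof -
  from f obtain C1 C2 where int: "integrable lborel f"
    and C1: "\<And>x. norm (f x) \<le> C1 * gauss (tanh s) x"
    and C2: "\<And>x. norm (fourier f x) \<le> C2 * gauss (tanh s) x"
    by (auto simp: hardy_class_def)
  have a: "tanh s > -1" by (rule tanh_real_gt_neg1)
  define q where "q = (1 - tanh s) / (1 + tanh s)"
  have "1 - tanh s = (cosh s - sinh s) / cosh s" "1 + tanh s = (cosh s + sinh s) / cosh s"
    by (simp_all add: tanh_def diff_divide_distrib add_divide_distrib)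
  then have "q = (cosh s - sinh s) / (cosh s + sinh s)"
    unfolding q_def by simp
  then have q: "q = exp (- s) * exp (- s)"
    by (simp add: cosh_plus_sinh cosh_minus_sinh exp_minus field_simps)
  define D where "D = max 1 (max C1 C2 * sqrt (2 * pi / (1 + tanh s)))"
  have rhs: "(q * u\<^sup>2 + v\<^sup>2) / 2 = exp (- s) / 2 * (cosh s * (u\<^sup>2 + v\<^sup>2) - sinh s * (u\<^sup>2 - v\<^sup>2))" for u v
  proof -
    have cs: "exp (- s) * cosh s = (1 + q) / 2" "exp (- s) * sinh s = (1 - q) / 2"
      by (simp_all add: q cosh_def sinh_def field_simps flip: exp_add)
    have "exp (- s) / 2 * (cosh s * (u\<^sup>2 + v\<^sup>2) - sinh s * (u\<^sup>2 - v\<^sup>2))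
       = (exp (- s) * cosh s) * (u\<^sup>2 + v\<^sup>2) / 2 - (exp (- s) * sinh s) * (u\<^sup>2 - v\<^sup>2) / 2"
      by (simp add: field_simps)
    also have "\<dots> = (q * u\<^sup>2 + v\<^sup>2) / 2"
      unfolding cs by (simp add: field_simps)
    finally show ?thesis ..
  qed
  have le_D: "C1 * sqrt (2 * pi / (1 + tanh s)) \<le> D" "C2 * sqrt (2 * pi / (1 + tanh s)) \<le> D"
    using a unfolding D_def
    by (intro conjI max.coboundedI2 mult_right_mono max.cobounded1 max.cobounded2 real_sqrt_ge_zero; simp)+
  have 1: "norm (bargmann f z)
      \<le> D * exp (exp (- s) / 2 * (cosh s * (norm z)\<^sup>2 - sinh s * Re (z\<^sup>2)))" for z
    using norm_bargmann_le[OF _ a C1, of z] int le_D(1) unfolding q_def[symmetric] rhs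
    by (auto simp: Re_power2 cmod_power2 borel_measurable_integrable intro: order_trans mult_right_mono)
  have 2: "norm (bargmann f z)
      \<le> D * exp (exp (- s) / 2 * (cosh s * (norm z)\<^sup>2 + sinh s * Re (z\<^sup>2)))" for z
  proof -
    have "norm (bargmann (fourier f) (\<i> * z))
      \<le> D * exp (exp (- s) / 2 * (cosh s * (norm (\<i> * z))\<^sup>2 - sinh s * Re ((\<i> * z)\<^sup>2)))"
      using norm_bargmann_le[OF fourier_measurable[OF int] a C2, of "\<i> * z"] le_D(2) unfolding q_def[symmetric] rhs
      by (auto simp: Re_power2 cmod_power2 norm_mult add.commute[of "(Im z)\<^sup>2"] intro: order_trans mult_right_mono)
    then show ?thesis by (simp add: bargmann_fourier[OF int] norm_mult power_mult_distrib)
  qed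
  have "norm (bargmann f z)
    \<le> D * exp (exp (- s) / 2 * (cosh s * (norm z)\<^sup>2 - sinh s * \<bar>Re (z\<^sup>2)\<bar>))" for z
    using 1[of z] 2[of z] by (cases "Re (z\<^sup>2) \<ge> 0") auto
  moreover have "D > 0" by (simp add: D_def less_max_iff_disj)
  ultimately show ?thesis by blast
qed

section \<open>Taylor coefficients\<close>

text \<open>Cauchy's formula on the circle of radius \<open>r\<close>; the derivative of the
  parametrization cancels one power of the denominator and the factor
  \<open>2 * pi * \<i>\<close>.\<close>

lemma power_series_coeff_has_integral:
  fixes F :: "complex \<Rightarrow> complex"
  assumes sums: "\<And>z. (\<lambda>n. \<beta> n * z ^ n) sums F z" and r: "r > 0"
  shows "((\<lambda>\<tau>. F (of_real r * cis (2 * pi * \<tau>)) * cis (- (n * (2 * pi * \<tau>)))) has_integral \<beta> n * of_real r ^ n) {0..1}"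
proof -
  have "F has_fps_expansion Abs_fps \<beta>"
    using sums by (intro has_fps_expansionI always_eventually) simp
  from fps_nth_fps_expansion[OF this, of n] have \<beta>: "(deriv ^^ n) F 0 = fact n * \<beta> n" by simp
  have hol: "F holomorphic_on ball 0 R" for R
    by (rule power_series_holomorphic[where a = \<beta>]) (simp add: sums)
  have "((\<lambda>u. F u / (u - 0) ^ Suc n) has_contour_integral
      2 * pi * \<i> / fact n * (deriv ^^ n) F 0) (circlepath 0 r)"
  proof (rule Cauchy_has_contour_integral_higher_derivative_circlepath)
    show "continuous_on (cball 0 r) F"
      by (rule continuous_on_subset[OF holomorphic_on_imp_continuous_on[OF hol[of "r + 1"]]]) auto
  qed (use hol r in auto)
  then have "((\<lambda>u. F u / u ^ Suc n) has_contour_integral 2 * pi * \<i> * \<beta> n) (circlepath 0 r)"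
    unfolding \<beta> diff_zero by (simp del: power_Suc add: mult.assoc)
  then have "((\<lambda>x. F (of_real r * cis (2 * pi * x)) / (of_real r * cis (2 * pi * x)) ^ Suc n
      * (2 * pi * \<i> * of_real r * cis (2 * pi * x))) has_integral 2 * pi * \<i> * \<beta> n) {0..1}"
    unfolding has_contour_integral vector_derivative_circlepath
    by (simp add: circlepath cis_conv_exp mult_ac)
  from has_integral_mult_right[OF this, of "of_real r ^ n / (2 * pi * \<i>)"]
  have "((\<lambda>x. of_real r ^ n / (2 * pi * \<i>) * (F (of_real r * cis (2 * pi * x)) / (of_real r * cis (2 * pi * x)) ^ Suc n
      * (2 * pi * \<i> * of_real r * cis (2 * pi * x)))) has_integral \<beta> n * of_real r ^ n) {0..1}"
    by (simp add: mult_ac)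
  moreover have "of_real r ^ n / (2 * pi * \<i>) * (F (of_real r * cis (2 * pi * x)) / (of_real r * cis (2 * pi * x)) ^ Suc n
      * (2 * pi * \<i> * of_real r * cis (2 * pi * x))) = F (of_real r * cis (2 * pi * x)) * cis (- (n * (2 * pi * x)))" for x
  proof -
    have "cis (- (n * (2 * pi * x))) = inverse (cis (2 * pi * x) ^ n)"
      by (simp add: Complex.DeMoivre)
    then show ?thesis using r by (simp add: power_mult_distrib field_simps)
  qed
  ultimately show ?thesis by simp
qed

lemma fact_le_stirling:
  assumes "n \<ge> 1"
  shows "fact n \<le> exp 1 * sqrt (real n) * (real n / exp 1) ^ n"
proof -
  have "ln (fact n) \<le> 1 + ln (real n) / 2 + real n * (ln (real n) - 1)"
    using assms
  proof (induction n rule: nat_induct_at_least)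
    case (Suc n)
    \<comment> \<open>The midpoint lower estimate for the integral of the reciprocal between
      \<open>n\<close> and \<open>n + 1\<close> drives the induction; the constant
      \<open>exp 1\<close> makes the case \<open>n = 1\<close> an equality.\<close>
    have "1 \<le> (n + 1 / 2) * (ln (n + 1) - ln n)"
      using ln_inverse_approx_ge[of "real n" "real n + 1"] Suc.hyps by (simp add: field_simps)
    then have "ln (real n + 1) + (1 + ln (real n) / 2 + real n * (ln (real n) - 1))
      \<le> 1 + ln (real n + 1) / 2 + (real n + 1) * (ln (real n + 1) - 1)"
      by (simp add: algebra_simps)
    then show ?case using Suc by (simp add: ln_mult add_ac)
  qed simp
  also have "\<dots> = ln (exp 1 * sqrt (real n) * (real n / exp 1) ^ n)"
    using assms by (simp add: ln_mult ln_sqrt ln_realpow ln_div)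
  finally show ?thesis using assms by simp
qed

text \<open>A scaled arctangent is an antiderivative, and its range has length \<open>pi\<close>.
  The resulting factor \<open>1 / sqrt m\<close> is uniform in the centre \<open>c\<close> and
  measures the angular width of the concentration.\<close>

lemma integral_cauchy_density_le:
  fixes c :: real
  assumes "m > 0"
  shows "(\<lambda>\<tau>. 1 / (1 + m * (2 * pi * \<tau> - c)\<^sup>2)) integrable_on {0..1}"
    and "integral {0..1} (\<lambda>\<tau>. 1 / (1 + m * (2 * pi * \<tau> - c)\<^sup>2)) \<le> 1 / (2 * sqrt m)"
proof -
  define G where "G = (\<lambda>\<tau>. arctan (sqrt m * (2 * pi * \<tau> - c)) / (2 * pi * sqrt m))"
  have "((\<lambda>\<tau>. 1 / (1 + m * (2 * pi * \<tau> - c)\<^sup>2)) has_integral G 1 - G 0) {0..1}"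
  proof (rule fundamental_theorem_of_calculus)
    fix \<tau> :: real
    have "1 + m * (2 * pi * \<tau> - c)\<^sup>2 > 0" using assms by (intro add_pos_nonneg) auto
    then have "(G has_real_derivative 1 / (1 + m * (2 * pi * \<tau> - c)\<^sup>2)) (at \<tau>)"
      unfolding G_def using assms
      by (auto intro!: derivative_eq_intros simp: power_mult_distrib divide_simps)
    then show "(G has_vector_derivative 1 / (1 + m * (2 * pi * \<tau> - c)\<^sup>2)) (at \<tau> within {0..1})"
      by (simp add: has_real_derivative_iff_has_vector_derivative has_vector_derivative_at_within)
  qed simp
  moreover have "G 1 - G 0 \<le> 1 / (2 * sqrt m)"
  proof -
    have "G 1 - G 0 = (arctan (sqrt m * (2 * pi * 1 - c)) - arctan (sqrt m * (2 * pi * 0 - c))) / (2 * pi * sqrt m)"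
      by (simp add: G_def diff_divide_distrib)
    also have "\<dots> \<le> pi / (2 * pi * sqrt m)"
      using arctan_bounded[of "sqrt m * (2 * pi * 1 - c)"] arctan_bounded[of "sqrt m * (2 * pi * 0 - c)"] assms
      by (intro divide_right_mono) auto
    finally show ?thesis by simp
  qed
  ultimately show "(\<lambda>\<tau>. 1 / (1 + m * (2 * pi * \<tau> - c)\<^sup>2)) integrable_on {0..1}"
    and "integral {0..1} (\<lambda>\<tau>. 1 / (1 + m * (2 * pi * \<tau> - c)\<^sup>2)) \<le> 1 / (2 * sqrt m)"
    by (auto simp: integrable_on_def integral_unique)
qed

lemma quarter_turn_decomposition:
  fixes \<theta> :: real
  assumes "0 \<le> \<theta>" "\<theta> \<le> 2 * pi"
  shows "\<exists>k<4::nat. \<bar>\<theta> - (pi / 4 + k * (pi / 2))\<bar> \<le> pi / 4"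
proof -
  consider "\<theta> \<le> pi / 2" | "pi / 2 \<le> \<theta>" "\<theta> \<le> pi" | "pi \<le> \<theta>" "\<theta> \<le> 3 * pi / 2" | "3 * pi / 2 \<le> \<theta>" by linarith
  then show ?thesis
  proof cases
    case 1 with assms show ?thesis by (intro exI[of _ 0]) (simp add: abs_le_iff field_simps)
  next
    case 2 then show ?thesis by (intro exI[of _ 1]) (simp add: abs_le_iff field_simps)
  next
    case 3 then show ?thesis by (intro exI[of _ 2]) (simp add: abs_le_iff field_simps)
  next
    case 4 with assms show ?thesis by (intro exI[of _ 3]) (simp add: abs_le_iff field_simps)
  qed
qed

text \<open>In the scale \<open>w = sqrt m * \<bar>y\<bar>\<close> the linear factor is at most
  \<open>4 * (1 + w\<^sup>2) / sqrt m\<close>, and the Gaussian absorbs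
  \<open>(1 + w\<^sup>2)\<^sup>2\<close>. The Cauchy density left over has an elementary
  integral.\<close>

lemma gaussian_weight_le:
  fixes \<kappa> m y :: real
  assumes \<kappa>: "\<kappa> > 0" and m: "m \<ge> 1"
  shows "(4 * \<bar>y\<bar> + 2 / m) * exp (- (\<kappa> * m * y\<^sup>2 / 2)) \<le> 4 * (1 + 4 / \<kappa>)\<^sup>2 / sqrt m * (1 / (1 + m * y\<^sup>2))"
proof -
  define w where "w = sqrt m * \<bar>y\<bar>"
  have w2: "w\<^sup>2 = m * y\<^sup>2" using m by (simp add: w_def power_mult_distrib)
  have w0: "w \<ge> 0" using m by (simp add: w_def)
  have pos: "1 + w\<^sup>2 > 0" by (intro add_pos_nonneg) auto
  have sm: "sqrt m \<ge> 1" using m by simp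
  have mm: "sqrt m * sqrt m = m" using m by simp
  have "2 / m \<le> 2 / sqrt m" using sm m mult_left_mono[OF sm, of "sqrt m"] mm by (intro divide_left_mono) auto
  moreover have "4 * \<bar>y\<bar> = 4 * w / sqrt m" using m by (simp add: w_def)
  ultimately have "4 * \<bar>y\<bar> + 2 / m \<le> (4 * w + 2) / sqrt m" by (simp add: add_divide_distrib)
  moreover have "4 * w + 2 \<le> 4 * (1 + w\<^sup>2)"
    using zero_le_power2[of "2 * w - 1"] by (simp add: power2_eq_square algebra_simps)
  ultimately have 1: "4 * \<bar>y\<bar> + 2 / m \<le> 4 * (1 + w\<^sup>2) / sqrt m"
    using m by (elim order_trans) (intro divide_right_mono, auto)
  have "1 + w\<^sup>2 \<le> (1 + 4 / \<kappa>) * (1 + \<kappa> * w\<^sup>2 / 4)"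
    using \<kappa> by (simp add: field_simps)
  also have "\<dots> \<le> (1 + 4 / \<kappa>) * exp (\<kappa> * w\<^sup>2 / 4)"
    using \<kappa> by (intro mult_left_mono exp_ge_add_one_self) auto
  finally have "(1 + w\<^sup>2)\<^sup>2 \<le> ((1 + 4 / \<kappa>) * exp (\<kappa> * w\<^sup>2 / 4))\<^sup>2"
    by (intro power_mono) auto
  also have "\<dots> = (1 + 4 / \<kappa>)\<^sup>2 * exp (\<kappa> * w\<^sup>2 / 2)"
    by (simp add: power_mult_distrib flip: exp_of_nat_mult)
  finally have "(1 + w\<^sup>2)\<^sup>2 * exp (- (\<kappa> * w\<^sup>2 / 2)) \<le> (1 + 4 / \<kappa>)\<^sup>2 * exp (\<kappa> * w\<^sup>2 / 2) * exp (- (\<kappa> * w\<^sup>2 / 2))"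
    by (rule mult_right_mono) simp
  also have "\<dots> = (1 + 4 / \<kappa>)\<^sup>2"
    by (simp add: mult.assoc mult_exp_exp)
  finally have "(1 + w\<^sup>2)\<^sup>2 * exp (- (\<kappa> * w\<^sup>2 / 2)) \<le> (1 + 4 / \<kappa>)\<^sup>2" .
  then have 2: "(1 + w\<^sup>2) * exp (- (\<kappa> * w\<^sup>2 / 2)) \<le> (1 + 4 / \<kappa>)\<^sup>2 / (1 + w\<^sup>2)"
    using pos by (simp add: pos_le_divide_eq power2_eq_square mult_ac)
  have "(4 * \<bar>y\<bar> + 2 / m) * exp (- (\<kappa> * w\<^sup>2 / 2)) \<le> 4 * (1 + w\<^sup>2) / sqrt m * exp (- (\<kappa> * w\<^sup>2 / 2))"
    by (intro mult_right_mono 1) auto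
  also have "\<dots> = 4 / sqrt m * ((1 + w\<^sup>2) * exp (- (\<kappa> * w\<^sup>2 / 2)))" by simp
  also have "\<dots> \<le> 4 / sqrt m * ((1 + 4 / \<kappa>)\<^sup>2 / (1 + w\<^sup>2))"
    using m by (intro mult_left_mono 2) auto
  finally show ?thesis by (simp add: w2 mult_ac)
qed

text \<open>Of the factor \<open>1 / real n\<close>, one square root comes from the
  near-cancellation on the diagonals and the other from the width of the four angular peaks; the
  rest is the maximum of \<open>F\<close> on the circle divided by \<open>r ^ n\<close>.\<close>

lemma combined_coefficient_bound:
  fixes F :: "complex \<Rightarrow> complex" and n :: nat
  assumes sums: "\<And>z. (\<lambda>n. \<beta> n * z ^ n) sums F z"
    and \<kappa>: "\<kappa> > 0" and C: "C > 0"
    and bnd: "\<And>r (k::nat) y. r \<ge> 0 \<Longrightarrow> \<bar>y\<bar> \<le> pi / 4 \<Longrightarrow>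
      norm (F (of_real r * cis (pi / 4 + k * (pi / 2) + y))) \<le> C * exp (exp (- (2 * t)) / 2 * r\<^sup>2 * (1 - \<kappa> * y\<^sup>2))"
    and n: "n \<ge> 1"
  shows "norm (\<beta> n + of_real (real n * real (n + 2) * exp (4 * t)) * \<beta> (n + 4))
    \<le> 8 * C * (1 + 4 / \<kappa>)\<^sup>2 * exp (real n / 2) / (real n * (sqrt (real n) * exp t) ^ n)"
proof -
  \<comment> \<open>This radius minimizes
    \<open>exp (exp (- (2 * t)) / 2 * r\<^sup>2) / r ^ n\<close>; there the exponent equals
    \<open>n / 2\<close>.\<close>
  define r where "r = sqrt (real n) * exp t"
  have r: "r > 0" using n by (simp add: r_def)
  have r2: "r\<^sup>2 = real n * exp (2 * t)" by (simp add: r_def power_mult_distrib flip: exp_of_nat_mult)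
  have r4: "r ^ 4 = (real n)\<^sup>2 * exp (4 * t)"
  proof -
    have "r ^ 4 = (r\<^sup>2)\<^sup>2" by simp
    then show ?thesis unfolding r2 by (simp add: power_mult_distrib flip: exp_of_nat_mult)
  qed
  \<comment> \<open>After scaling by \<open>r ^ n\<close>, the coefficient of index
    \<open>n + 4\<close> enters with weight \<open>\<mu>\<close>, which differs from 1 by only
    \<open>2 / n\<close>.\<close>
  define \<mu> where "\<mu> = 1 + 2 / real n"
  have \<mu>r: "\<mu> * r ^ 4 = real n * real (n + 2) * exp (4 * t)"
    using n by (simp add: \<mu>_def r4 field_simps power2_eq_square)
  define d where "d = \<beta> n + of_real (real n * real (n + 2) * exp (4 * t)) * \<beta> (n + 4)"
  define z where "z = (\<lambda>\<tau>. of_real r * cis (2 * pi * \<tau>))"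
  define h where "h = (\<lambda>\<tau>. F (z \<tau>) * cis (- (n * (2 * pi * \<tau>))) + of_real \<mu> * (F (z \<tau>) * cis (- ((n + 4) * (2 * pi * \<tau>)))))"
  have h: "(h has_integral d * of_real r ^ n) {0..1}"
  proof -
    have "(h has_integral (\<beta> n * of_real r ^ n + of_real \<mu> * (\<beta> (n + 4) * of_real r ^ (n + 4)))) {0..1}"
      unfolding h_def z_def using power_series_coeff_has_integral[OF sums r]
      by (intro has_integral_add has_integral_mult_right) blast+
    also have "\<beta> n * of_real r ^ n + of_real \<mu> * (\<beta> (n + 4) * of_real r ^ (n + 4))
        = (\<beta> n + of_real (\<mu> * r ^ 4) * \<beta> (n + 4)) * of_real r ^ n"
      by (simp add: power_add algebra_simps)
    finally show ?thesis unfolding \<mu>r d_def .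
  qed
  define A where "A = 4 * C * (1 + 4 / \<kappa>)\<^sup>2 * exp (real n / 2) / sqrt (real n)"
  have A: "A \<ge> 0" using C by (simp add: A_def)
  \<comment> \<open>One peak per diagonal. Summing all four gives an integrable majorant that does
    not depend on which quadrant \<tau> falls into.\<close>
  define g where "g = (\<lambda>(k::nat) \<tau>. 1 / (1 + real n * (2 * pi * \<tau> - (pi / 4 + k * (pi / 2)))\<^sup>2))"
  have g0: "g k \<tau> \<ge> 0" for k \<tau> by (simp add: g_def)
  have n0: "real n > 0" using n by simp
  have gi: "g k integrable_on {0..1}" "integral {0..1} (g k) \<le> 1 / (2 * sqrt (real n))" for k
    unfolding g_def using integral_cauchy_density_le[OF n0] by blast+
  have h_le: "norm (h \<tau>) \<le> A * (\<Sum>k<4. g k \<tau>)" if \<tau>: "\<tau> \<in> {0..1}" for \<tau>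
  proof -
    obtain k :: nat where k: "k < 4" "\<bar>2 * pi * \<tau> - (pi / 4 + k * (pi / 2))\<bar> \<le> pi / 4"
      using quarter_turn_decomposition[of "2 * pi * \<tau>"] \<tau> by auto
    define y where "y = 2 * pi * \<tau> - (pi / 4 + k * (pi / 2))"
    have y: "\<bar>y\<bar> \<le> pi / 4" using k by (simp add: y_def)
    have th: "2 * pi * \<tau> = pi / 4 + k * (pi / 2) + y" by (simp add: y_def)
    have "norm (F (z \<tau>)) \<le> C * exp (exp (- (2 * t)) / 2 * r\<^sup>2 * (1 - \<kappa> * y\<^sup>2))"
      unfolding z_def th using bnd[of r y k] r y by simp
    also have "exp (- (2 * t)) / 2 * r\<^sup>2 * (1 - \<kappa> * y\<^sup>2) = real n / 2 + - (\<kappa> * real n * y\<^sup>2 / 2)"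
      unfolding r2 by (simp add: exp_minus field_simps)
    finally have Fz: "norm (F (z \<tau>)) \<le> C * exp (real n / 2) * exp (- (\<kappa> * real n * y\<^sup>2 / 2))"
      unfolding exp_add by (simp only: mult.assoc)
    \<comment> \<open>On every diagonal four times the angle is an odd multiple of
      \<open>pi\<close>. The sign flips, so the combined factor becomes
      \<open>1 - \<mu> * cis (- (4 * y))\<close>, of size
      \<open>O(\<bar>y\<bar> + 1 / n)\<close>.\<close>
    have c4: "cis (- (4 * (2 * pi * \<tau>))) = - cis (- (4 * y))"
    proof -
      have "- (4 * (2 * pi * \<tau>)) = - pi + - (2 * pi * real k) + - (4 * y)"
        unfolding th by (simp add: algebra_simps)
      moreover have "cis (2 * pi * real k) = 1" by (rule cis_multiple_2pi) simp
      moreover have "cis (- (2 * pi * real k)) = 1"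
        by (metis \<open>cis (2 * pi * real k) = 1\<close> cis_inverse inverse_1)
      moreover have "cis (- pi) = - 1" by (simp add: complex_eq_iff)
      ultimately show ?thesis by (simp only: flip: cis_mult) simp
    qed
    have "h \<tau> = F (z \<tau>) * cis (- (n * (2 * pi * \<tau>))) * (1 + of_real \<mu> * cis (- (4 * (2 * pi * \<tau>))))"
      by (simp add: h_def algebra_simps cis_mult)
    then have "norm (h \<tau>) = norm (F (z \<tau>)) * norm (1 - of_real \<mu> * cis (- (4 * y)))"
      unfolding c4 by (simp add: norm_mult)
    also have "norm (1 - of_real \<mu> * cis (- (4 * y))) \<le> 4 * \<bar>y\<bar> + 2 / real n"
    proof -
      have "norm (1 - cis (- (4 * y))) \<le> \<bar>4 * y\<bar>"
        using iexp_approx1[of "- (4 * y)" 0] by (simp add: cis_conv_exp norm_minus_commute)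
      moreover have "norm (of_real (2 / real n) * cis (- (4 * y))) = 2 / real n"
        by (simp add: norm_mult norm_divide)
      moreover have "1 - of_real \<mu> * cis (- (4 * y)) = (1 - cis (- (4 * y))) - of_real (2 / real n) * cis (- (4 * y))"
        by (simp add: \<mu>_def algebra_simps)
      ultimately show ?thesis
        using norm_triangle_ineq4[of "1 - cis (- (4 * y))" "of_real (2 / real n) * cis (- (4 * y))"]
        by (simp only: abs_mult)
    qed
    finally have "norm (h \<tau>) \<le> norm (F (z \<tau>)) * (4 * \<bar>y\<bar> + 2 / real n)"
      by (simp add: mult_left_mono)
    also have "\<dots> \<le> C * exp (real n / 2) * exp (- (\<kappa> * real n * y\<^sup>2 / 2)) * (4 * \<bar>y\<bar> + 2 / real n)"
      by (intro mult_right_mono Fz) auto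
    also have "\<dots> = C * exp (real n / 2) * ((4 * \<bar>y\<bar> + 2 / real n) * exp (- (\<kappa> * real n * y\<^sup>2 / 2)))"
      by simp
    also have "\<dots> \<le> C * exp (real n / 2) * (4 * (1 + 4 / \<kappa>)\<^sup>2 / sqrt (real n) * (1 / (1 + real n * y\<^sup>2)))"
      using C n by (intro mult_left_mono gaussian_weight_le \<kappa>) auto
    also have "\<dots> = A * g k \<tau>" by (simp add: A_def g_def y_def)
    also have "\<dots> \<le> A * (\<Sum>k<4. g k \<tau>)"
      using k A g0 by (intro mult_left_mono member_le_sum) auto
    finally show ?thesis .
  qed
  have "norm (d * of_real r ^ n) = norm (integral {0..1} h)"
    using h by (simp add: integral_unique)
  also have "\<dots> \<le> integral {0..1} (\<lambda>\<tau>. A * (\<Sum>k<4. g k \<tau>))"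
    using h h_le gi(1)
    by (intro integral_norm_bound_integral integrable_on_mult_right integrable_sum) auto
  also have "\<dots> = A * (\<Sum>k<4. integral {0..1} (g k))"
    using gi(1) by (simp add: integral_sum)
  also have "\<dots> \<le> A * (\<Sum>k<(4::nat). 1 / (2 * sqrt (real n)))"
    using gi(2) A by (intro mult_left_mono sum_mono) auto
  also have "\<dots> = 8 * C * (1 + 4 / \<kappa>)\<^sup>2 * exp (real n / 2) / real n"
    using n by (simp add: A_def field_simps flip: power2_eq_square)
  finally have "norm d * r ^ n \<le> 8 * C * (1 + 4 / \<kappa>)\<^sup>2 * exp (real n / 2) / real n"
    using r by (simp add: norm_mult norm_power)
  then show ?thesis
    using r n unfolding d_def[symmetric] r_def[symmetric] by (simp add: field_simps)
qed

section \<open>From Taylor coefficients back to Hermite coefficients\<close>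

theorem theorem1p1:
  fixes t :: real and f :: "real \<Rightarrow> complex"
  assumes "t > 0" and "f \<in> hardy_class (tanh (2 * t))"
  shows "\<exists>C>0. \<forall>n::nat. n \<ge> 1 \<longrightarrow>
    norm (hermite_coeff f n +
      complex_of_real (real n * real (n + 2) / sqrt (\<Prod>j=1..4. real (n + j)) * exp (4 * t))
        * hermite_coeff f (n + 4))
    \<le> C * real n powr (-3/4) * exp (- real n * t)"
proof -
  have int: "integrable lborel f" using assms by (simp add: hardy_class_def)
  define \<beta> where "\<beta> = (\<lambda>n. hermite_coeff f n * of_real (sqrt (sqrt pi) / sqrt (fact n)))"
  have sums: "(\<lambda>n. \<beta> n * z ^ n) sums bargmann f z" for z
    unfolding \<beta>_def by (rule bargmann_sums[OF int])
  obtain C0 where C0: "C0 > 0" and C0_bnd: "\<And>z. norm (bargmann f z)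
      \<le> C0 * exp (exp (- (2 * t)) / 2 * (cosh (2 * t) * (norm z)\<^sup>2 - sinh (2 * t) * \<bar>Re (z\<^sup>2)\<bar>))"
    using hardy_class_bargmann_bound[of "2 * t" f] assms by auto
  obtain \<kappa> C1 where \<kappa>: "\<kappa> > 0" and C1: "C1 > 0" and C1_bnd: "\<And>r (k::nat) y. r \<ge> 0 \<Longrightarrow> \<bar>y\<bar> \<le> pi / 4 \<Longrightarrow>
      norm (bargmann f (of_real r * cis (pi / 4 + k * (pi / 2) + y))) \<le> C1 * exp (exp (- (2 * t)) / 2 * r\<^sup>2 * (1 - \<kappa> * y\<^sup>2))"
    using hardy_indicator_bound[OF holomorphic_bargmann[OF int] C0 _ _ C0_bnd] assms(1) by auto
  define K where "K = 8 * C1 * (1 + 4 / \<kappa>)\<^sup>2 * sqrt (exp 1) / sqrt (sqrt pi)"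
  have K: "K > 0"
  proof -
    have "1 + 4 / \<kappa> > 0" using \<kappa> by (simp add: add_pos_pos)
    then show ?thesis using C1 by (simp add: K_def)
  qed
  have "norm (hermite_coeff f n +
      complex_of_real (real n * real (n + 2) / sqrt (\<Prod>j=1..4. real (n + j)) * exp (4 * t))
        * hermite_coeff f (n + 4))
    \<le> K * real n powr (-3/4) * exp (- real n * t)" (is "norm ?lhs \<le> _") if n: "n \<ge> 1" for n :: nat
  proof -
    define P where "P = (\<Prod>j=1..4. real (n + j))"
    have P: "P > 0" unfolding P_def by (intro prod_pos) auto
    \<comment> \<open>Passing from \<beta> back to Hermite coefficients multiplies by
      \<open>sqrt (fact m)\<close>, so the denominator \<open>sqrt P\<close> of the theorem exactly
      turns the factor for \<open>n + 4\<close> into that for \<open>n\<close>.\<close>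
    have fP: "fact (n + 4) = fact n * P"
      by (simp add: P_def numeral_eq_Suc prod.atLeast_Suc_atMost algebra_simps)
    define d where "d = \<beta> n + of_real (real n * real (n + 2) * exp (4 * t)) * \<beta> (n + 4)"
    have hc: "hermite_coeff f m = of_real (sqrt (fact m) / sqrt (sqrt pi)) * \<beta> m" for m
      by (simp add: \<beta>_def)
    have "real n * real (n + 2) / sqrt P * exp (4 * t) * (sqrt (fact (n + 4)) / sqrt (sqrt pi))
        = sqrt (fact n) / sqrt (sqrt pi) * (real n * real (n + 2) * exp (4 * t))"
      unfolding fP real_sqrt_mult using P by simp
    then have "?lhs = of_real (sqrt (fact n) / sqrt (sqrt pi)) * d"
      unfolding hc P_def[symmetric] d_def distrib_left mult.assoc[symmetric] of_real_mult[symmetric] by simp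
    then have "norm ?lhs = sqrt (fact n) / sqrt (sqrt pi) * norm d"
      by (simp add: norm_mult norm_divide)
    \<comment> \<open>Stirling supplies \<open>n powr (1 / 4)\<close> and the coefficient bound
      \<open>1 / n\<close>, together the power \<open>-3/4\<close>. The factors
      \<open>n powr (n / 2)\<close> and \<open>exp (n / 2)\<close> cancel, and
      \<open>exp (- n * t)\<close> remains from the radius.\<close>
    also have "\<dots> \<le> (sqrt (exp 1) * real n powr (1 / 4) * (real n powr (n / 2) * exp (- n / 2))) / sqrt (sqrt pi)
        * (8 * C1 * (1 + 4 / \<kappa>)\<^sup>2 * exp (real n / 2) / (real n powr 1 * (real n powr (n / 2) * exp (n * t))))"
    proof (intro mult_mono divide_right_mono)
      have "sqrt (fact n) \<le> sqrt (exp 1 * sqrt (real n) * (real n / exp 1) ^ n)"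
        using fact_le_stirling[OF n] by simp
      also have "\<dots> = sqrt (exp 1) * sqrt (sqrt (real n)) * sqrt ((real n / exp 1) ^ n)"
        by (simp add: real_sqrt_mult)
      also have "sqrt (sqrt (real n)) = real n powr (1 / 4)"
        by (simp add: powr_powr flip: powr_half_sqrt)
      also have "sqrt ((real n / exp 1) ^ n) = real n powr (n / 2) * exp (- n / 2)"
      proof -
        have "sqrt ((real n / exp 1) ^ n) = ((real n / exp 1) powr n) powr (1 / 2)"
          using n by (simp add: powr_half_sqrt powr_realpow)
        also have "\<dots> = (real n / exp 1) powr (n / 2)" by (simp add: powr_powr)
        also have "\<dots> = real n powr (n / 2) * exp (- n / 2)"
          using n by (simp add: powr_divide exp_powr_real exp_minus field_simps)
        finally show ?thesis .
      qed
      finally show "sqrt (fact n) \<le> sqrt (exp 1) * real n powr (1 / 4) * (real n powr (n / 2) * exp (- n / 2))" .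
      have "(sqrt (real n) * exp t) ^ n = real n powr (n / 2) * exp (n * t)"
      proof -
        have "sqrt (real n) ^ n = (real n powr (1 / 2)) powr n"
          using n by (simp add: powr_half_sqrt powr_realpow)
        also have "\<dots> = real n powr (n / 2)" by (simp add: powr_powr)
        finally show ?thesis by (simp add: power_mult_distrib exp_of_nat_mult)
      qed
      then show "norm d \<le> 8 * C1 * (1 + 4 / \<kappa>)\<^sup>2 * exp (real n / 2) / (real n powr 1 * (real n powr (n / 2) * exp (n * t)))"
        using combined_coefficient_bound[OF sums \<kappa> C1 C1_bnd n] n unfolding d_def by simp
    qed auto
    also have "\<dots> = K * (real n powr (1 / 4) / real n powr 1) * exp (- real n * t)"
      using n by (simp add: K_def exp_minus field_simps)
    also have "real n powr (1 / 4) / real n powr 1 = real n powr (-3/4)"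
      using powr_diff[of "real n" "1 / 4" 1] by simp
    finally show ?thesis .
  qed
  with K show ?thesis by blast
qed

end
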